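(* Let $k\in\mathbb{N}$, let $p$ be a real number, and let $A$ be an analytic function in the unit disc $\mathbb{D}$. Consider the linear differential equation $f^{(k)}+Af=0$ in $\mathbb{D}$. Then the following are equivalent: (1) $\sigma_{M,\deg}(A)=\lambda_{M,\deg}(A)=p>2k$; (2) $\sigma_M(f)=\lambda_M(f)=p/k-1>1$ for some non-trivial solution $f$ of $f^{(k)}+Af=0$; (3) $\sigma_M(f)=\lambda_M(f)=p/k-1>1$ for all non-trivial solutions $f$ of $f^{(k)}+Af=0$.
   Context: $\mathbb{D}=\{z\in\mathbb{C}:|z|<1\}$, $\mathbb{N}=\{1,2,\dots\}$, $M(r,g)=\max_{|z|=r}|g(z)|$, and $\log^+x=\max\{\log x,0\}$ (with $\log^+0=0$). For $f$ analytic in $\mathbb{D}$, the order and lower order of growth are $$\sigma_M(f)=\limsup_{r\to1^-}\frac{\log^+\log^+M(r,f)}{\log\frac1{1-r}},\qquad \lambda_M(f)=\liminf_{r\to1^-}\frac{\log^+\log^+M(r,f)}{\log\frac1{1-r}}.$$ For $A$ analytic in $\mathbb{D}$, the degree and lower degree of growth are $$\sigma_{M,\deg}(A)=\limsup_{r\to1^-}\frac{\log^+M(r,A)}{\log\frac1{1-r}},\qquad \lambda_{M,\deg}(A)=\liminf_{r\to1^-}\frac{\log^+M(r,A)}{\log\frac1{1-r}}.$$ Solutions are analytic functions in $\mathbb{D}$; non-trivial means not identically zero. *)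

theory Defs
  imports "HOL-Complex_Analysis.Complex_Analysis"
begin

definition log_plus :: "real \<Rightarrow> real" where
  "log_plus x = (if x \<le> 0 then 0 else max (ln x) 0)"

(* For g continuous on the compact circle the supremum is attained, so it is the maximum. *)
definition max_modulus :: "real \<Rightarrow> (complex \<Rightarrow> complex) \<Rightarrow> real" where
  "max_modulus r g = (SUP z\<in>sphere 0 r. norm (g z))"

(* The growth quantities may be infinite, hence their values are extended reals. *)
definition growth_order :: "(complex \<Rightarrow> complex) \<Rightarrow> ereal" where
  "growth_order f =
     Limsup (at_left 1) (\<lambda>r. ereal (log_plus (log_plus (max_modulus r f)) / ln (1 / (1 - r))))"

definition lower_growth_order :: "(complex \<Rightarrow> complex) \<Rightarrow> ereal" where
  "lower_growth_order f =
     Liminf (at_left 1) (\<lambda>r. ereal (log_plus (log_plus (max_modulus r f)) / ln (1 / (1 - r))))"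

definition growth_degree :: "(complex \<Rightarrow> complex) \<Rightarrow> ereal" where
  "growth_degree A =
     Limsup (at_left 1) (\<lambda>r. ereal (log_plus (max_modulus r A) / ln (1 / (1 - r))))"

definition lower_growth_degree :: "(complex \<Rightarrow> complex) \<Rightarrow> ereal" where
  "lower_growth_degree A =
     Liminf (at_left 1) (\<lambda>r. ereal (log_plus (max_modulus r A) / ln (1 / (1 - r))))"

(* Functions on the disc are represented by total functions whose values outside
   the disc are irrelevant; so "non-trivial" must refer to a point of the disc. *)
definition nontrivial_solution :: "nat \<Rightarrow> (complex \<Rightarrow> complex) \<Rightarrow> (complex \<Rightarrow> complex) \<Rightarrow> bool" where
  "nontrivial_solution k A f \<longleftrightarrow>
     f holomorphic_on ball 0 1 \<and>
     (\<forall>z\<in>ball 0 1. (deriv ^^ k) f z + A z * f z = 0) \<and>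
     (\<exists>z\<in>ball 0 1. f z \<noteq> 0)"

end

theory Submission
  imports Defs
begin

text \<open>
Upper bounds for solutions come from a Gronwall estimate along rays, which turns
\<open>|A| \<le> C (1 - |z|)\<^bsup>-kq\<^esup>\<close> into \<open>log |f| \<le> B (1 - |z|)\<^bsup>1-q\<^esup>\<close>. Conversely, \<open>A = - f\<^bsup>(k)\<^esup>/f\<close>, and
\<open>f\<^bsup>(k)\<^esup>/f\<close> is controlled near a point at distance \<open>\<delta>\<close> from the boundary as soon as \<open>|f|\<close> is not too small
somewhere within distance of order \<open>\<delta>\<close>: if \<open>log |f|\<close> lies between \<open>-K\<close> and \<open>L\<close> there, then
\<open>|A| \<le> C ((K + L + 1)\<^bsup>1+\<epsilon>\<^esup>/\<delta>)\<^bsup>k\<^esup>\<close>. A lower bound for \<open>|f|\<close> at scale \<open>R\<close> propagates to scale \<open>\<delta> \<le> R\<close> with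
loss factor \<open>R/\<delta>\<close>; iterating this gives \<open>K = O(\<delta>\<^bsup>-\<sigma>\<^esup>)\<close> when \<open>f\<close> has order below \<open>\<sigma> > 1\<close>.

For the lower quantities, suppose that \<open>log |f| \<le> \<delta>\<^bsup>-s\<^esup>\<close> at one scale \<open>\<delta>\<close> with \<open>s < \<sigma>\<close>. Propagating from
scale \<open>\<delta>\<^bsup>s/\<sigma>\<^esup>\<close> gives \<open>K = O(\<delta>\<^bsup>-\<tau>\<^esup>)\<close> with \<open>\<tau> = s + 1 - s/\<sigma>\<close>, and \<open>\<tau> < \<sigma>\<close> because \<open>\<sigma> > 1\<close>; so \<open>A\<close> is too
small at that scale. Likewise a single scale at which \<open>A\<close> is small makes \<open>f\<close> too small there.
\<close>

section \<open>Growth quantities\<close>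

text \<open>Exponents correspond as follows: |A| of size (1 - |z|)^(-kq) goes with log |f| of size
  (1 - |z|)^(1-q), so degree p = kq matches order p/k - 1, and p > 2k says that the order exceeds 1.
  Two obstacles shape the argument. The quotient of a derivative of f by f explodes at the zeros of
  f, so pointwise estimates leave out exceptional sets, whereas a liminf has to be controlled at
  every radius close to 1. Hence the estimates are stated scale by scale, and exceptional points are
  crossed by the maximum principle for A. Moreover zeros may crowd together; their total
  contribution is controlled only with the power 1 + \<epsilon>, which is harmless because an order
  does not see arbitrarily small changes of the exponent. The implications run in a cycle from (1)
  to (3) to (2) to (1); only the middle one needs the existence of a solution on the whole
  disc.\<close>

lemma log_plus_le_iff: "0 \<le> y \<Longrightarrow> log_plus x \<le> y \<longleftrightarrow> x \<le> exp y"
proof (cases "x \<le> 0")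
  case True
  then have "x \<le> exp y" using exp_ge_zero[of y] by linarith
  then show "0 \<le> y \<Longrightarrow> ?thesis" using True by (simp add: log_plus_def)
next
  case False
  have "ln x \<le> y \<longleftrightarrow> exp (ln x) \<le> exp y" by simp
  then have "ln x \<le> y \<longleftrightarrow> x \<le> exp y" using False by simp
  then show "0 \<le> y \<Longrightarrow> ?thesis" using False by (simp add: log_plus_def)
qed

lemma less_log_plus_iff: "0 \<le> y \<Longrightarrow> y < log_plus x \<longleftrightarrow> exp y < x"
  using log_plus_le_iff[of y x] by linarith

text \<open>By the maximum principle a bound on one circle holds on the whole closed disc, so a
  single radius with small maximum gives information on all smaller ones. Compactness of the circle
  supplies the boundedness that the supremum in \<open>max_modulus\<close> needs.\<close>

lemma norm_le_max_modulus:
  assumes hol: "f holomorphic_on ball 0 1" and r: "r < 1" "norm z \<le> r"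
  shows "norm (f z) \<le> max_modulus r f"
proof (rule maximum_modulus_frontier[where S = "cball 0 r" and f = f])
  have hc: "f holomorphic_on cball 0 r"
    using hol by (rule holomorphic_on_subset) (use r in auto)
  show "f holomorphic_on interior (cball 0 r)"
    by (rule holomorphic_on_subset[OF hc interior_subset])
  show "continuous_on (closure (cball 0 r)) f"
    using holomorphic_on_imp_continuous_on[OF hc] by simp
  fix w assume w: "w \<in> frontier (cball (0::complex) r)"
  have "continuous_on (sphere 0 r) (\<lambda>z. norm (f z))"
    using holomorphic_on_imp_continuous_on[OF hc] sphere_cball
    by (intro continuous_on_norm) (blast intro: continuous_on_subset)
  then have "compact ((\<lambda>z. norm (f z)) ` sphere 0 r)"
    by (intro compact_continuous_image) auto
  then have "bdd_above ((\<lambda>z. norm (f z)) ` sphere 0 r)"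
    by (intro bounded_imp_bdd_above compact_imp_bounded)
  then show "norm (f w) \<le> max_modulus r f"
    unfolding max_modulus_def using w by (intro cSUP_upper) (simp_all add: frontier_cball)
qed (use r in auto)

lemma max_modulus_le:
  assumes "0 \<le> r" "\<And>z. norm z = r \<Longrightarrow> norm (f z) \<le> B"
  shows "max_modulus r f \<le> B"
  unfolding max_modulus_def using assms by (intro cSUP_least) auto

text \<open>Any increase of the exponent absorbs a multiplicative constant, which is why estimates
  may be proved up to constants. The threshold solves
  \<open>d powr (- (e' - e)) = \<bar>C\<bar> + 2\<close>; the summand 2 makes the right side exceed
  1, so that \<open>d < 1\<close>.\<close>

lemma powr_neg_absorb_const:
  fixes C e e' :: real
  assumes "e < e'"
  shows "\<exists>d>0. d < 1 \<and> (\<forall>\<delta>. 0 < \<delta> \<longrightarrow> \<delta> < d \<longrightarrow> C * \<delta> powr (- e) < \<delta> powr (- e'))"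
proof -
  define d where "d = (\<bar>C\<bar> + 2) powr (- (1/(e' - e)))"
  have d: "0 < d" by (simp add: d_def)
  have "d < (\<bar>C\<bar> + 2) powr 0" unfolding d_def using assms by (intro powr_less_mono) auto
  moreover have "\<bar>C\<bar> + 2 \<noteq> 0" by linarith
  ultimately have "d < 1" by simp
  moreover have "C * \<delta> powr (- e) < \<delta> powr (- e')" if \<delta>: "0 < \<delta>" "\<delta> < d" for \<delta>
  proof -
    have "d powr (- (e' - e)) < \<delta> powr (- (e' - e))"
      using \<delta> assms by (intro powr_less_mono2_neg) auto
    moreover have "d powr (- (e' - e)) = \<bar>C\<bar> + 2" 
    proof -
      have "- (1/h) * - h = 1" if "0 < h" for h :: real using that by simp
      from this[of "e' - e"] have "- (1/(e' - e)) * - (e' - e) = 1" using assms by linarith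
      then show ?thesis unfolding d_def powr_powr by simp
    qed
    ultimately have "C < \<delta> powr (- (e' - e))" by linarith
    then have "C * \<delta> powr (- e) < \<delta> powr (- (e' - e)) * \<delta> powr (- e)"
      using \<delta> by (intro mult_strict_right_mono) auto
    then show ?thesis by (simp flip: powr_add)
  qed
  ultimately show ?thesis using d by blast
qed

lemma log_ratio:
  fixes r y :: real
  assumes "0 < r" "r < 1"
  shows "0 < ln (1/(1-r))" "exp (y * ln (1/(1-r))) = (1 - r) powr (- y)"
  using assms by (auto simp: powr_def ln_div)

text \<open>Together with the next three lemmas this translates growth quantities into power
  inequalities near the boundary: for the degree \<open>g\<close> is the maximum modulus, for the
  order it is the \<open>log_plus\<close> of it. Exponents are kept nonnegative because
  \<open>log_plus\<close> truncates at 0.\<close>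

lemma Limsup_log_ratioD:
  fixes g :: "real \<Rightarrow> real"
  assumes "Limsup (at_left 1) (\<lambda>r. ereal (log_plus (g r) / ln (1/(1-r)))) \<le> ereal y" "y < y'" "0 \<le> y'"
  shows "\<exists>b<1. 0 \<le> b \<and> (\<forall>r. b < r \<longrightarrow> r < 1 \<longrightarrow> g r \<le> (1 - r) powr (- y'))"
proof -
  have "\<forall>\<^sub>F r in at_left 1. ereal (log_plus (g r) / ln (1/(1-r))) < ereal y'"
    using assms Limsup_le_iff[of "at_left 1"] by (metis ereal_less_eq(3) less_ereal.simps(1) order.strict_trans1)
  then obtain b where b: "b < 1" "\<And>r. b < r \<Longrightarrow> r < 1 \<Longrightarrow> log_plus (g r) / ln (1/(1-r)) < y'"
    unfolding eventually_at_left_field by auto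
  have "g r \<le> (1 - r) powr (- y')" if "max b 0 < r" "r < 1" for r
  proof -
    have L: "0 < ln (1/(1-r))" using log_ratio that by simp
    have "log_plus (g r) \<le> y' * ln (1/(1-r))" using b(2)[of r] that L by (simp add: divide_less_eq)
    then have "g r \<le> exp (y' * ln (1/(1-r)))" using assms L by (subst (asm) log_plus_le_iff) auto
    then show ?thesis using log_ratio(2)[of r y'] that by simp
  qed
  then show ?thesis using b(1) by (intro exI[of _ "max b 0"]) auto
qed

lemma Limsup_log_ratioI:
  fixes g :: "real \<Rightarrow> real"
  assumes "0 \<le> y"
    and "\<And>y'. y < y' \<Longrightarrow> \<exists>C b. b < 1 \<and> (\<forall>r. b < r \<longrightarrow> r < 1 \<longrightarrow> g r \<le> C * (1 - r) powr (- y'))"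
  shows "Limsup (at_left 1) (\<lambda>r. ereal (log_plus (g r) / ln (1/(1-r)))) \<le> ereal y"
  unfolding Limsup_le_iff
proof (intro allI impI)
  fix y0 :: ereal assume y0: "ereal y < y0"
  show "\<forall>\<^sub>F r in at_left 1. ereal (log_plus (g r) / ln (1/(1-r))) < y0"
  proof (cases y0)
    case (real z)
    with y0 have "y < z" by simp
    \<comment> \<open>Of the two exponents between \<open>y\<close> and \<open>z\<close>,
      \<open>y1\<close> enters the hypothesis, and the room up to \<open>y2\<close> absorbs
      \<open>C\<close>.\<close>
    define y1 where "y1 = y + (z - y)/3"
    define y2 where "y2 = y + 2*(z - y)/3"
    have yy: "y < y1" "y1 < y2" "y2 < z" "0 \<le> y2"
      using \<open>y < z\<close> assms(1) by (auto simp: y1_def y2_def field_simps)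
    obtain C b where b: "b < 1" "\<And>r. b < r \<Longrightarrow> r < 1 \<Longrightarrow> g r \<le> C * (1 - r) powr (- y1)"
      using assms(2)[OF yy(1)] by blast
    obtain d where d: "0 < d" "d < 1" "\<And>\<delta>. 0 < \<delta> \<Longrightarrow> \<delta> < d \<Longrightarrow> C * \<delta> powr (- y1) < \<delta> powr (- y2)"
      using powr_neg_absorb_const[OF yy(2), of C] by blast
    have "log_plus (g r) / ln (1/(1-r)) < z" if r: "max b (1 - d) < r" "r < 1" for r
    proof -
      have L: "0 < ln (1/(1-r))" using log_ratio[of r] r d by simp
      have "g r \<le> (1 - r) powr (- y2)" using b(2)[of r] d(3)[of "1 - r"] r by simp
      also have "\<dots> = exp (y2 * ln (1/(1-r)))" using log_ratio(2)[of r y2] r d by simp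
      finally have "log_plus (g r) \<le> y2 * ln (1/(1-r))" using L yy by (subst log_plus_le_iff) auto
      then have "log_plus (g r) / ln (1/(1-r)) \<le> y2" using L by (simp add: divide_le_eq)
      then show ?thesis using yy by simp
    qed
    then show ?thesis unfolding eventually_at_left_field real
      using b(1) d(1) by (intro exI[of _ "max b (1 - d)"]) auto
  qed (use y0 in auto)
qed

lemma Liminf_log_ratioD:
  fixes g :: "real \<Rightarrow> real"
  assumes "ereal y \<le> Liminf (at_left 1) (\<lambda>r. ereal (log_plus (g r) / ln (1/(1-r))))" "y' < y" "0 \<le> y'"
  shows "\<exists>b<1. 0 \<le> b \<and> (\<forall>r. b < r \<longrightarrow> r < 1 \<longrightarrow> (1 - r) powr (- y') < g r)"
proof -
  have "\<forall>\<^sub>F r in at_left 1. ereal y' < ereal (log_plus (g r) / ln (1/(1-r)))"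
    using assms(1,2) unfolding le_Liminf_iff by (metis less_ereal.simps(1))
  then obtain b where b: "b < 1" "\<And>r. b < r \<Longrightarrow> r < 1 \<Longrightarrow> y' < log_plus (g r) / ln (1/(1-r))"
    unfolding eventually_at_left_field by auto
  have "(1 - r) powr (- y') < g r" if "max b 0 < r" "r < 1" for r
  proof -
    have L: "0 < ln (1/(1-r))" using log_ratio that by simp
    have "y' * ln (1/(1-r)) < log_plus (g r)" using b(2)[of r] that L by (simp add: less_divide_eq)
    then have "exp (y' * ln (1/(1-r))) < g r" using assms L by (subst (asm) less_log_plus_iff) auto
    then show ?thesis using log_ratio(2)[of r y'] that by simp
  qed
  then show ?thesis using b(1) by (intro exI[of _ "max b 0"]) auto
qed

lemma Liminf_log_ratioI:
  fixes g :: "real \<Rightarrow> real"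
  assumes "0 < y"
    and "\<And>y'. y' < y \<Longrightarrow> 0 \<le> y' \<Longrightarrow> \<exists>b<1. \<forall>r. b < r \<longrightarrow> r < 1 \<longrightarrow> (1 - r) powr (- y') < g r"
  shows "ereal y \<le> Liminf (at_left 1) (\<lambda>r. ereal (log_plus (g r) / ln (1/(1-r))))"
  unfolding le_Liminf_iff
proof (intro allI impI)
  fix y0 :: ereal assume y0: "y0 < ereal y"
  show "\<forall>\<^sub>F r in at_left 1. y0 < ereal (log_plus (g r) / ln (1/(1-r)))"
  proof (cases y0)
    case (real z)
    \<comment> \<open>Below 0 the truncated \<open>log_plus\<close> says nothing, so a negative
      \<open>z\<close> is replaced by 0; \<open>0 < y\<close> keeps the replacement below
      \<open>y\<close>.\<close>
    define y' where "y' = max z 0"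
    have y': "y' < y" "0 \<le> y'" "z \<le> y'" using y0 real assms(1) by (auto simp: y'_def)
    obtain b where b: "b < 1" "\<And>r. b < r \<Longrightarrow> r < 1 \<Longrightarrow> (1 - r) powr (- y') < g r"
      using assms(2)[OF y'(1,2)] by blast
    have "z < log_plus (g r) / ln (1/(1-r))" if r: "max b 0 < r" "r < 1" for r
    proof -
      have L: "0 < ln (1/(1-r))" using log_ratio[of r] r by simp
      have "exp (y' * ln (1/(1-r))) < g r" using b(2)[of r] log_ratio(2)[of r y'] r by simp
      then have "y' * ln (1/(1-r)) < log_plus (g r)" using L y' by (subst less_log_plus_iff) auto
      then have "y' < log_plus (g r) / ln (1/(1-r))" using L by (simp add: less_divide_eq)
      then show ?thesis using y' by simp
    qed
    then show ?thesis unfolding eventually_at_left_field real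
      using b(1) by (intro exI[of _ "max b 0"]) auto
  qed (use y0 in auto)
qed

section \<open>Growth of solutions\<close>

text \<open>With weight \<open>m\<close> comparable to \<open>|A|\<^bsup>-1/k\<^esup>\<close> all terms have the same size, and the logarithmic
derivative of the energy along a ray is at most \<open>2/m\<close>.\<close>

definition energy :: "nat \<Rightarrow> (complex \<Rightarrow> complex) \<Rightarrow> complex \<Rightarrow> real \<Rightarrow> real \<Rightarrow> real" where
  "energy k f u m t = (\<Sum>j<k. m ^ (2*j) * (norm ((deriv ^^ j) f (of_real t * u)))\<^sup>2)"

text \<open>The square of the norm stays differentiable at the zeros of \<open>F\<close>, so the
  energy can be differentiated along the whole ray.\<close>

lemma has_real_derivative_norm_sq_ray:
  assumes hol: "F holomorphic_on ball 0 1" and t: "of_real t * u \<in> ball 0 1"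
  shows "((\<lambda>t. (norm (F (of_real t * u)))\<^sup>2) has_real_derivative
            2 * inner (F (of_real t * u)) (deriv F (of_real t * u) * u)) (at t)"
proof -
  let ?h = "\<lambda>t. F (of_real t * u)"
  have "((\<lambda>t. of_real t * u) has_vector_derivative u) (at t)"
    by (auto intro!: derivative_eq_intros)
  moreover have "(F has_field_derivative deriv F (of_real t * u)) (at (of_real t * u))"
    using hol t by (intro holomorphic_derivI[OF _ open_ball]) auto
  ultimately have "(F \<circ> (\<lambda>t. of_real t * u) has_vector_derivative (u * deriv F (of_real t * u))) (at t)"
    by (rule field_vector_diff_chain_at)
  then have "(?h has_vector_derivative (deriv F (of_real t * u) * u)) (at t)"
    by (simp add: o_def mult.commute)
  from bounded_bilinear.has_vector_derivative[OF bounded_bilinear_inner this this]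
  have "((\<lambda>t. inner (?h t) (?h t)) has_vector_derivative
          2 * inner (F (of_real t * u)) (deriv F (of_real t * u) * u)) (at t)"
    by (simp add: inner_commute)
  then show ?thesis
    by (simp add: has_real_derivative_iff_has_vector_derivative power2_norm_eq_inner)
qed

text \<open>The scaled norms \<open>X j\<close> form a cyclic chain: differentiating the j-th term
  of the energy produces \<open>X j\<close> times \<open>X (Suc j)\<close> over \<open>m\<close>,
  and the equation with the size condition on \<open>A\<close> leads from the last derivative back
  to \<open>X 0\<close>. A decreasing weight only adds nonpositive terms. As \<open>N\<close> is a
  primitive of \<open>1 / \<mu> t\<close>, \<open>exp (- 2 * N t)\<close> is the integrating
  factor.\<close>

lemma energy_gronwall:
  fixes f A :: "complex \<Rightarrow> complex" and \<mu> N \<mu>' :: "real \<Rightarrow> real"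
  assumes hol: "f holomorphic_on ball 0 1" and k: "1 \<le> k"
    and ode: "\<forall>z\<in>ball 0 1. (deriv ^^ k) f z + A z * f z = 0"
    and u: "norm u = 1" and ab: "0 \<le> a" "a \<le> b" "b < 1"
    and \<mu>: "\<And>t. a \<le> t \<Longrightarrow> t \<le> b \<Longrightarrow> 0 < \<mu> t"
      "\<And>t. a \<le> t \<Longrightarrow> t \<le> b \<Longrightarrow> (\<mu> has_real_derivative \<mu>' t) (at t)"
      "\<And>t. a \<le> t \<Longrightarrow> t \<le> b \<Longrightarrow> \<mu>' t \<le> 0"
    and N: "\<And>t. a \<le> t \<Longrightarrow> t \<le> b \<Longrightarrow> (N has_real_derivative 1 / \<mu> t) (at t)"
    and A: "\<And>t. a \<le> t \<Longrightarrow> t \<le> b \<Longrightarrow> norm (A (of_real t * u)) * \<mu> t ^ k \<le> 1"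
  shows "energy k f u (\<mu> b) b \<le> energy k f u (\<mu> a) a * exp (2 * (N b - N a))"
proof -
  define W where "W = (\<lambda>t. energy k f u (\<mu> t) t * exp (- 2 * N t))"
  have "W b \<le> W a"
  proof (rule DERIV_nonpos_imp_nonincreasing[OF ab(2)])
    fix t assume t: "a \<le> t" "t \<le> b"
    define m where "m = \<mu> t"
    have m: "0 < m" using \<mu>(1) t by (simp add: m_def)
    define z where "z = of_real t * u"
    have zb: "z \<in> ball 0 1" using t ab u by (simp add: z_def norm_mult)
    define F where "F = (\<lambda>j. (deriv ^^ j) f)"
    have dF: "deriv (F j) = F (Suc j)" for j by (simp add: F_def)
    \<comment> \<open>At \<open>j = 0\<close> the truncated exponent \<open>2*j-1\<close> is
      harmless because the factor \<open>real (2*j)\<close> vanishes.\<close>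
    define V' where "V' = (\<Sum>j<k. real (2*j) * m ^ (2*j-1) * \<mu>' t * (norm (F j z))\<^sup>2
                       + m ^ (2*j) * (2 * inner (F j z) (F (Suc j) z * u)))"
    have "((\<lambda>t. energy k f u (\<mu> t) t) has_real_derivative V') (at t)"
      unfolding energy_def V'_def
    proof (rule DERIV_sum)
      fix j assume "j \<in> {..<k}"
      have Fj: "F j holomorphic_on ball 0 1"
        unfolding F_def using hol by (intro holomorphic_higher_deriv) auto
      have 1: "((\<lambda>t. \<mu> t ^ (2*j)) has_real_derivative real (2*j) * m ^ (2*j-1) * \<mu>' t) (at t)"
        unfolding m_def using \<mu>(2)[OF t] by (auto intro!: derivative_eq_intros)
      have 2: "((\<lambda>t. (norm ((deriv ^^ j) f (of_real t * u)))\<^sup>2) has_real_derivative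
            2 * inner (F j z) (F (Suc j) z * u)) (at t)"
        using has_real_derivative_norm_sq_ray[OF Fj, of t u] zb unfolding dF by (simp add: z_def F_def)
      show "((\<lambda>t. \<mu> t ^ (2*j) * (norm ((deriv ^^ j) f (of_real t * u)))\<^sup>2) has_real_derivative
          real (2*j) * m ^ (2*j-1) * \<mu>' t * (norm (F j z))\<^sup>2
                       + m ^ (2*j) * (2 * inner (F j z) (F (Suc j) z * u))) (at t)"
        using DERIV_mult[OF 1 2] by (simp add: m_def F_def z_def mult_ac)
    qed
    then have DW: "(W has_real_derivative (V' - 2 * (1/m) * energy k f u m t) * exp (- 2 * N t)) (at t)"
      unfolding W_def using N[OF t]
      by (auto intro!: derivative_eq_intros simp: m_def algebra_simps)
    \<comment> \<open>Index \<open>k\<close> is wrapped around to 0, so shifting the index leaves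
      the sum of squares unchanged.\<close>
    define X where "X = (\<lambda>j. if j < k then m ^ j * norm (F j z) else norm (F 0 z))"
    have E: "energy k f u m t = (\<Sum>j<k. (X j)\<^sup>2)"
      unfolding energy_def X_def
      by (intro sum.cong refl) (simp add: power_mult_distrib F_def z_def power_mult mult.commute flip: power_mult)
    have "V' \<le> (\<Sum>j<k. (1/m) * ((X j)\<^sup>2 + (X (Suc j))\<^sup>2))"
      unfolding V'_def
    proof (rule sum_mono)
      fix j assume "j \<in> {..<k}"
      then have j: "j < k" by simp
      have "real (2*j) * m ^ (2*j-1) * \<mu>' t * (norm (F j z))\<^sup>2 \<le> 0"
        using \<mu>(3)[OF t] m by (intro mult_nonpos_nonneg mult_nonneg_nonpos mult_nonneg_nonneg) auto
      moreover have "m ^ (2*j) * (2 * inner (F j z) (F (Suc j) z * u)) \<le> (1/m) * (2 * (X j * X (Suc j)))"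
      proof -
        have "inner (F j z) (F (Suc j) z * u) \<le> norm (F j z) * norm (F (Suc j) z)"
          using norm_cauchy_schwarz[of "F j z" "F (Suc j) z * u"] u by (simp add: norm_mult)
        then have "m ^ (2*j) * inner (F j z) (F (Suc j) z * u) \<le> m ^ (2*j) * (norm (F j z) * norm (F (Suc j) z))"
          using m by (intro mult_left_mono) auto
        also have "\<dots> = (1/m) * (m ^ j * norm (F j z)) * (m ^ Suc j * norm (F (Suc j) z))"
          using m by (simp add: field_simps power_mult power2_eq_square mult_2 power_add)
        also have "\<dots> \<le> (1/m) * X j * X (Suc j)"
        proof (cases "Suc j < k")
          case True
          then show ?thesis by (simp add: X_def)
        next
          case False
          then have kj: "k = Suc j" using j by simp
          have "F k z = - (A z * F 0 z)" using ode zb by (simp add: F_def eq_neg_iff_add_eq_0)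
          then have "m ^ k * norm (F k z) = (norm (A z) * m ^ k) * norm (F 0 z)"
            by (simp add: norm_mult)
          also have "\<dots> \<le> 1 * norm (F 0 z)"
            using A[OF t] by (intro mult_right_mono) (auto simp: z_def m_def)
          finally have "m ^ Suc j * norm (F (Suc j) z) \<le> X (Suc j)" using kj by (simp add: X_def)
          then show ?thesis using m j by (intro mult_mono) (auto simp: X_def)
        qed
        finally show ?thesis by simp
      qed
      moreover have "(1/m) * (2 * (X j * X (Suc j))) \<le> (1/m) * ((X j)\<^sup>2 + (X (Suc j))\<^sup>2)"
        using m sum_squares_bound[of "X j" "X (Suc j)"] by (intro mult_left_mono) (auto simp: mult_ac)
      ultimately show "real (2*j) * m ^ (2*j-1) * \<mu>' t * (norm (F j z))\<^sup>2
                       + m ^ (2*j) * (2 * inner (F j z) (F (Suc j) z * u))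
                     \<le> (1/m) * ((X j)\<^sup>2 + (X (Suc j))\<^sup>2)" by linarith
    qed
    also have "\<dots> = (1/m) * ((\<Sum>j<k. (X j)\<^sup>2) + (\<Sum>j<k. (X (Suc j))\<^sup>2))"
      by (simp only: sum_distrib_left[symmetric] sum.distrib)
    also have "(\<Sum>j<k. (X (Suc j))\<^sup>2) = (\<Sum>j<k. (X j)\<^sup>2)"
    proof -
      have "(\<Sum>j<k. (X (Suc j))\<^sup>2) + (X 0)\<^sup>2 = (\<Sum>j<Suc k. (X j)\<^sup>2)"
        by (subst sum.lessThan_Suc_shift) simp
      moreover have "X k = X 0" using k by (simp add: X_def)
      ultimately show ?thesis by simp
    qed
    finally have "V' \<le> 2 * (1/m) * energy k f u m t" by (simp add: E)
    then have "(V' - 2 * (1/m) * energy k f u m t) * exp (- 2 * N t) \<le> 0"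
      by (intro mult_nonpos_nonneg) auto
    with DW show "\<exists>y. (W has_real_derivative y) (at t) \<and> y \<le> 0" by blast
  qed
  then have "energy k f u (\<mu> b) b * exp (- 2 * N b) * exp (2 * N b)
      \<le> energy k f u (\<mu> a) a * exp (- 2 * N a) * exp (2 * N b)"
    unfolding W_def by (rule mult_right_mono) simp
  then show ?thesis by (simp add: mult.assoc right_diff_distrib flip: exp_add)
qed

text \<open>Two regimes: up to radius \<open>1 - T\<close> the weight is \<open>c (1 - t)\<^bsup>q\<^esup>\<close>, beyond it is frozen; the choice
\<open>T\<^bsup>q\<^esup> = \<delta>\<^bsup>q'\<^esup>\<close> makes both contributions to the exponent equal to a multiple of \<open>T\<^bsup>1-q\<^esup>\<close>. The case
\<open>q' = q\<close> is the plain growth estimate.\<close>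

lemma solution_growth_bound:
  fixes f A :: "complex \<Rightarrow> complex"
  assumes hol: "f holomorphic_on ball 0 1" and k: "1 \<le> k"
    and ode: "\<forall>z\<in>ball 0 1. (deriv ^^ k) f z + A z * f z = 0"
    and q: "1 < q" and C: "1 \<le> C"
    and A: "\<And>z. norm z < 1 \<Longrightarrow> norm (A z) \<le> C * (1 - norm z) powr (- (real k * q))"
  shows "\<exists>B\<ge>0. \<forall>\<delta> q' u. 0 < \<delta> \<longrightarrow> \<delta> < 1 \<longrightarrow> 0 \<le> q' \<longrightarrow> q' \<le> q \<longrightarrow> norm u = 1 \<longrightarrow>
      (\<forall>z. norm z \<le> 1 - \<delta> \<longrightarrow> norm (A z) \<le> C * \<delta> powr (- (real k * q'))) \<longrightarrow>
      norm (f (of_real (1 - \<delta>) * u)) \<le> exp (B * \<delta> powr (- (q'/q * (q - 1))))"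
proof -
  \<comment> \<open>Normalised by \<open>C * c ^ k = 1\<close>, so that the weight
    \<open>c * (1 - t) powr q\<close> just meets the size condition of
    \<open>energy_gronwall\<close>.\<close>
  define c where "c = C powr (- 1 / real k)"
  have c: "0 < c" "c \<le> 1" "C * c ^ k = 1"
  proof -
    show "0 < c" using C by (simp add: c_def)
    have "c \<le> C powr 0" unfolding c_def using C by (intro powr_mono) auto
    then show "c \<le> 1" using C by simp
    have "c ^ k = C powr (- 1 / real k * real k)" using C by (simp add: c_def powr_power mult.commute)
    then show "C * c ^ k = 1" using C k by (simp add: powr_minus)
  qed
  define E0 where "E0 = (\<Sum>j<k. (norm ((deriv ^^ j) f 0))\<^sup>2)"
  have E0: "0 \<le> E0" unfolding E0_def by (intro sum_nonneg) auto
  define B1 where "B1 = 1 / (c * (q - 1)) + 1 / c"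
  have B1: "0 \<le> B1" using c q by (simp add: B1_def)
  \<comment> \<open>The term \<open>ln (E0 + 1)\<close> moves the initial energy into the exponent,
    which is possible because the power \<open>P\<close> below is at least 1.\<close>
  define B where "B = B1 + ln (E0 + 1)"
  have "0 \<le> B" using B1 E0 by (simp add: B_def)
  moreover have "norm (f (of_real (1 - \<delta>) * u)) \<le> exp (B * \<delta> powr (- (q'/q * (q - 1))))"
    if \<delta>: "0 < \<delta>" "\<delta> < 1" and q': "0 \<le> q'" "q' \<le> q" and u: "norm u = 1"
      and A': "\<And>z. norm z \<le> 1 - \<delta> \<Longrightarrow> norm (A z) \<le> C * \<delta> powr (- (real k * q'))" for \<delta> q' u
  proof -
    define T where "T = \<delta> powr (q'/q)"
    have T0: "0 < T" using \<delta> by (simp add: T_def)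
    have T1: "T \<le> 1" unfolding T_def using \<delta> q' q by (intro powr_le1) auto
    have T\<delta>: "\<delta> \<le> T"
    proof -
      have "\<delta> powr 1 \<le> \<delta> powr (q'/q)" using \<delta> q q' by (intro powr_mono') auto
      then show ?thesis using \<delta> by (simp add: T_def)
    qed
    have Tq: "T powr q = \<delta> powr q'" using q by (simp add: T_def powr_powr)
    define N where "N = (\<lambda>t. (1 - t) powr (1 - q) / (c * (q - 1)))"
    have 1: "energy k f u (c * (1 - (1 - T)) powr q) (1 - T) \<le> energy k f u (c * (1 - 0) powr q) 0 * exp (2 * (N (1 - T) - N 0))"
    proof (rule energy_gronwall[OF hol k ode u, where \<mu>' = "\<lambda>t. - c * q * (1 - t) powr (q - 1)"])
      fix t assume t: "0 \<le> t" "t \<le> 1 - T"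
      then have t1: "0 < 1 - t" using T0 by linarith
      show "0 < c * (1 - t) powr q" using t1 c by simp
      show "((\<lambda>t. c * (1 - t) powr q) has_real_derivative - c * q * (1 - t) powr (q - 1)) (at t)"
        using t1 by (auto intro!: derivative_eq_intros)
      show "- c * q * (1 - t) powr (q - 1) \<le> 0" using c q by simp
      have "(N has_real_derivative - ((1 - q) * (1 - t) powr (1 - q - 1)) / (c * (q - 1))) (at t)"
        unfolding N_def using t1 q c by (auto intro!: derivative_eq_intros)
      also have "- ((1 - q) * (1 - t) powr (1 - q - 1)) / (c * (q - 1)) = (1 - t) powr (- q) / c"
        using q c by (simp add: field_simps)
      also have "\<dots> = 1 / (c * (1 - t) powr q)" by (simp add: powr_minus field_simps)
      finally show "(N has_real_derivative 1 / (c * (1 - t) powr q)) (at t)" .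
      have nt: "norm (of_real t * u) = t" using t u by (simp add: norm_mult)
      have "norm (A (of_real t * u)) * (c * (1 - t) powr q) ^ k
          \<le> C * (1 - t) powr (- (real k * q)) * (c * (1 - t) powr q) ^ k"
        using A[of "of_real t * u"] nt t1 c by (intro mult_right_mono) auto
      also have "\<dots> = (C * c ^ k) * ((1 - t) powr (- (real k * q)) * (1 - t) powr (real k * q))"
        using t1 by (simp add: power_mult_distrib powr_power mult.commute)
      also have "\<dots> = 1" using t1 c by (simp flip: powr_add)
      finally show "norm (A (of_real t * u)) * (c * (1 - t) powr q) ^ k \<le> 1" .
    qed (use T0 T1 in auto)
    have 2: "energy k f u (c * T powr q) (1 - \<delta>)
        \<le> energy k f u (c * T powr q) (1 - T) * exp (2 * ((1 - \<delta>) / (c * T powr q) - (1 - T) / (c * T powr q)))"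
    proof (rule energy_gronwall[OF hol k ode u, where \<mu>' = "\<lambda>t. 0" and \<mu> = "\<lambda>t. c * T powr q" and N = "\<lambda>t. t / (c * T powr q)"])
      fix t assume t: "1 - T \<le> t" "t \<le> 1 - \<delta>"
      show "0 < c * T powr q" using c T0 by simp
      show "((\<lambda>t. t / (c * T powr q)) has_real_derivative 1 / (c * T powr q)) (at t)"
        using c T0 by (auto intro!: derivative_eq_intros)
      have nt: "norm (of_real t * u) = t" using t T1 u by (simp add: norm_mult)
      have "norm (A (of_real t * u)) * (c * T powr q) ^ k
          \<le> C * \<delta> powr (- (real k * q')) * (c * T powr q) ^ k"
        using A'[of "of_real t * u"] nt t c by (intro mult_right_mono) auto
      also have "\<dots> = (C * c ^ k) * (\<delta> powr (- (real k * q')) * \<delta> powr (real k * q'))"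
        using \<delta> by (simp add: power_mult_distrib powr_power mult.commute Tq)
      also have "\<dots> = 1" using \<delta> c by (simp flip: powr_add)
      finally show "norm (A (of_real t * u)) * (c * T powr q) ^ k \<le> 1" .
    qed (use T0 T1 T\<delta> \<delta> in auto)
    define P where "P = T powr (1 - q)"
    have P1: "1 \<le> P"
    proof -
      have "T powr 0 \<le> T powr (1 - q)" using T0 T1 q by (intro powr_mono') auto
      then show ?thesis using T0 by (simp add: P_def)
    qed
    have "energy k f u (c * (1 - 0) powr q) 0 \<le> E0"
      unfolding energy_def E0_def using c
      by (intro sum_mono) (auto intro!: mult_left_le_one_le power_le_one)
    moreover have "N (1 - T) - N 0 \<le> P / (c * (q - 1))" using c q by (simp add: N_def P_def)
    ultimately have "energy k f u (c * (1 - 0) powr q) 0 * exp (2 * (N (1 - T) - N 0))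
        \<le> E0 * exp (2 * (P / (c * (q - 1))))"
      using E0 by (intro mult_mono) auto
    with 1 have 3: "energy k f u (c * T powr q) (1 - T) \<le> E0 * exp (2 * (P / (c * (q - 1))))" by simp
    have "(1 - \<delta>) / (c * T powr q) - (1 - T) / (c * T powr q) = (T - \<delta>) / (c * T powr q)"
      by (simp flip: diff_divide_distrib)
    also have "\<dots> \<le> T / (c * T powr q)" using \<delta> c by (intro divide_right_mono) auto
    also have "\<dots> = P / c" using T0 by (simp add: P_def powr_diff)
    finally have D: "(1 - \<delta>) / (c * T powr q) - (1 - T) / (c * T powr q) \<le> P / c" .
    have "energy k f u (c * T powr q) (1 - T) * exp (2 * ((1 - \<delta>) / (c * T powr q) - (1 - T) / (c * T powr q)))
        \<le> (E0 * exp (2 * (P / (c * (q - 1))))) * exp (2 * (P / c))"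
      by (intro mult_mono 3) (simp_all only: exp_le_cancel_iff D mult_le_cancel_left_pos zero_less_numeral
            exp_ge_zero mult_nonneg_nonneg E0)
    with 2 have "energy k f u (c * T powr q) (1 - \<delta>) \<le> E0 * exp (2 * (B1 * P))"
      by (simp add: B1_def distrib_right distrib_left mult.assoc flip: exp_add)
    moreover have "(norm (f (of_real (1 - \<delta>) * u)))\<^sup>2 \<le> energy k f u (c * T powr q) (1 - \<delta>)"
    proof -
      let ?e = "\<lambda>j. (c * T powr q) ^ (2*j) * (norm ((deriv ^^ j) f (of_real (1 - \<delta>) * u)))\<^sup>2"
      have "?e 0 \<le> (\<Sum>j<k. ?e j)"
        using k by (intro member_le_sum) auto
      then show ?thesis by (simp add: energy_def)
    qed
    moreover have "E0 * exp (2 * (B1 * P)) \<le> ((E0 + 1) * exp (B1 * P))\<^sup>2"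
    proof -
      have "E0 * 1 \<le> (E0 + 1) * (E0 + 1)" using E0 by (intro mult_mono) auto
      then have "E0 * exp (2 * (B1 * P)) \<le> (E0 + 1) * (E0 + 1) * exp (2 * (B1 * P))"
        unfolding mult_1_right by (rule mult_right_mono) simp
      also have "\<dots> = ((E0 + 1) * exp (B1 * P))\<^sup>2"
        unfolding power_mult_distrib by (simp add: power2_eq_square flip: exp_add)
      finally show ?thesis .
    qed
    ultimately have "(norm (f (of_real (1 - \<delta>) * u)))\<^sup>2 \<le> ((E0 + 1) * exp (B1 * P))\<^sup>2" by linarith
    then have "norm (f (of_real (1 - \<delta>) * u)) \<le> (E0 + 1) * exp (B1 * P)"
      by (rule power2_le_imp_le) (use E0 in auto)
    also have "\<dots> = exp (ln (E0 + 1) * 1 + B1 * P)" using E0 by (simp add: exp_add)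
    also have "\<dots> \<le> exp (B * P)"
      using P1 E0 by (simp add: B_def distrib_right mult_left_mono[of 1 P "ln (E0 + 1)", simplified])
    also have "P = \<delta> powr (- (q'/q * (q - 1)))"
    proof -
      have "x * (1 - q) = - (x * (q - 1))" for x by (simp add: algebra_simps)
      then show ?thesis unfolding P_def T_def powr_powr by simp
    qed
    finally show ?thesis .
  qed
  ultimately show ?thesis by blast
qed

section \<open>Lower bounds near the boundary\<close>

text \<open>Let b(z) = r (z - p) / (r^2 - cnj p z) be the Blaschke factor of the disc of radius r
  with zero p. Divided by |r^2 - cnj p z|^2, the identity computes 1 - |b|^2, which vanishes on |z|
  = r and is large when both points are far from that circle.\<close>

lemma blaschke_norm_identity:
  fixes p z :: complex and r :: real
  shows "(norm (of_real (r\<^sup>2) - cnj p * z))\<^sup>2 - r\<^sup>2 * (norm (z - p))\<^sup>2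
         = (r\<^sup>2 - (norm z)\<^sup>2) * (r\<^sup>2 - (norm p)\<^sup>2)"
  by (simp only: cmod_power2) (simp add: power2_eq_square algebra_simps)

text \<open>Maximum principle for \<open>f b\<^bsup>-n\<^esup>\<close> off a small disc, where \<open>b\<close> is the Blaschke factor of the disc of radius
\<open>1 - \<delta>/2\<close> with zero \<open>(1 - \<delta>) u\<close>: at distance \<open>R\<close> from the boundary \<open>1 - |b|\<close> is of order \<open>\<delta>/R\<close>.\<close>

lemma lower_bound_propagation:
  fixes f :: "complex \<Rightarrow> complex"
  assumes holf: "f holomorphic_on ball 0 1" and u: "norm u = 1"
    and d: "0 < \<delta>" "\<delta> \<le> R" "R \<le> 1/4"
    and fH: "\<And>z. norm z \<le> 1 - \<delta>/2 \<Longrightarrow> norm (f z) \<le> exp H"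
    and H: "0 \<le> H" "0 \<le> H'"
    and v: "dist v (of_real (1 - R) * u) \<le> R/64" "exp (- H') \<le> norm (f v)"
  shows "\<exists>w. dist w (of_real (1 - \<delta>) * u) \<le> \<delta>/64
             \<and> exp (- (400 * (R/\<delta>) * (H + H' + 1))) \<le> norm (f w)"
proof (rule ccontr)
  define K where "K = 400 * (R/\<delta>) * (H + H' + 1)"
  define p where "p = of_real (1 - \<delta>) * u"
  define r where "r = 1 - \<delta>/2"
  assume "\<not> ?thesis"
  then have neg: "norm (f w) < exp (- K)" if "dist w p \<le> \<delta>/64" for w
    using that unfolding K_def p_def by (meson not_le)
  have R: "0 < R" using d by simp
  have X1: "1 \<le> R/\<delta>" using d by simp
  have KH: "H' + H \<le> K"
  proof -
    have "1 * (H + H' + 1) \<le> 400 * (R/\<delta>) * (H + H' + 1)"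
      using X1 H by (intro mult_right_mono) auto
    then show ?thesis unfolding K_def by simp
  qed
  have np: "norm p = 1 - \<delta>" using d u by (simp add: p_def norm_mult del: of_real_diff)
  have r: "7/8 \<le> r" "r < 1" using d by (auto simp: r_def)
  have nv: "norm v \<le> 1 - R + R/64"
  proof -
    have "norm v \<le> norm (of_real (1 - R) * u) + dist v (of_real (1 - R) * u)"
      by (metis dist_norm norm_triangle_sub)
    also have "norm (of_real (1 - R) * u) = 1 - R" using d u by (simp add: norm_mult del: of_real_diff)
    finally show ?thesis using v by simp
  qed
  have vp: "\<not> dist v p \<le> \<delta>/64"
  proof
    assume "dist v p \<le> \<delta>/64"
    then have "norm (f v) < exp (- K)" by (rule neg)
    then have "exp (-H') < exp (-K)" using v(2) by linarith
    then show False using KH H by simp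
  qed
  \<comment> \<open>On the small circle around \<open>p\<close> the function \<open>q\<close> below
    is at most \<open>exp 6\<close>, so this is the largest power for which the assumed smallness
    \<open>exp (- K)\<close> of \<open>f\<close> there still yields the bound
    \<open>exp H\<close>.\<close>
  define n where "n = nat \<lfloor>(K + H)/6\<rfloor>"
  have n: "6 * real n \<le> K + H" "K + H < 6 * real n + 6"
  proof -
    have "0 \<le> K + H" using KH H by simp
    then have "real n = of_int \<lfloor>(K + H)/6\<rfloor>" unfolding n_def by simp
    moreover have "of_int \<lfloor>(K + H)/6\<rfloor> \<le> (K + H)/6" "(K + H)/6 < of_int \<lfloor>(K + H)/6\<rfloor> + 1"
      by (rule of_int_floor_le, rule real_of_int_floor_add_one_gt)
    ultimately have "real n \<le> (K + H)/6" "(K + H)/6 < real n + 1" by linarith+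
    then show "6 * real n \<le> K + H" "K + H < 6 * real n + 6" by (auto simp: field_simps)
  qed
  \<comment> \<open>The reciprocal of the Blaschke factor: it has modulus 1 on
    \<open>norm z = r\<close>, is bounded on the circle of radius \<open>\<delta>/64\<close> around
    \<open>p\<close>, and at \<open>v\<close> exceeds 1 by at least a multiple of
    \<open>\<delta>/R\<close>.\<close>
  define q where "q = (\<lambda>z. (of_real (r\<^sup>2) - cnj p * z) / (of_real r * (z - p)))"
  define S where "S = cball 0 r - ball p (\<delta>/64)"
  have "norm (f v * q v ^ n) \<le> exp H"
  proof (rule maximum_modulus_frontier[where f = "\<lambda>z. f z * q z ^ n" and S = S])
    have hol: "(\<lambda>z. f z * q z ^ n) holomorphic_on (ball 0 1 - {p})"
      unfolding q_def using r
      by (intro holomorphic_intros holomorphic_on_subset[OF holf]) auto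
    have SS: "S \<subseteq> ball 0 1 - {p}" using r d by (auto simp: S_def)
    have cS: "closed S" unfolding S_def by auto
    show "(\<lambda>z. f z * q z ^ n) holomorphic_on interior S"
      using hol SS interior_subset by (blast intro: holomorphic_on_subset)
    show "continuous_on (closure S) (\<lambda>z. f z * q z ^ n)"
      using holomorphic_on_imp_continuous_on[OF hol] SS cS
      by (metis closure_closed continuous_on_subset)
    show "bounded S" unfolding S_def by (meson bounded_cball bounded_diff)
    show "v \<in> S" using vp nv d by (auto simp: S_def r_def dist_commute)
    fix z assume "z \<in> frontier S"
    then have zS: "z \<in> S" "z \<notin> interior S" using cS by (auto simp: frontier_def)
    have "z \<notin> ball 0 r - cball p (\<delta>/64)"
    proof
      assume *: "z \<in> ball 0 r - cball p (\<delta>/64)"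
      have "ball 0 r - cball p (\<delta>/64) \<subseteq> S" by (auto simp: S_def)
      then have "ball 0 r - cball p (\<delta>/64) \<subseteq> interior S"
        by (intro interior_maximal) auto
      with * zS show False by auto
    qed
    then consider "norm z = r" | "dist p z = \<delta>/64" using zS(1) by (auto simp: S_def)
    then show "norm (f z * q z ^ n) \<le> exp H"
    proof cases
      case 1
      have "(norm (of_real (r\<^sup>2) - cnj p * z))\<^sup>2 = (r * norm (z - p))\<^sup>2"
        using blaschke_norm_identity[of r p z] 1 by (simp add: power_mult_distrib)
      then have "norm (of_real (r\<^sup>2) - cnj p * z) = r * norm (z - p)"
        using r by (simp add: power2_eq_iff_nonneg)
      moreover have "z \<noteq> p" using zS(1) d by (auto simp: S_def)
      ultimately have "norm (q z) = 1" using r by (simp add: q_def norm_divide norm_mult)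
      then have "norm (f z * q z ^ n) = norm (f z)" by (simp add: norm_mult norm_power)
      also have "\<dots> \<le> exp H" using 1 by (intro fH) (auto simp: r_def)
      finally show ?thesis .
    next
      case 2
      have "of_real (r\<^sup>2) - cnj p * z = of_real (r\<^sup>2 - (norm p)\<^sup>2) - cnj p * (z - p)"
        using complex_norm_square[of p] by (simp add: algebra_simps)
      then have "norm (of_real (r\<^sup>2) - cnj p * z) \<le> \<bar>r\<^sup>2 - (norm p)\<^sup>2\<bar> + norm p * norm (z - p)"
        by (metis complex_mod_cnj norm_mult norm_of_real norm_triangle_ineq4)
      also have "\<bar>r\<^sup>2 - (norm p)\<^sup>2\<bar> \<le> \<delta>"
      proof -
        have "r\<^sup>2 - (norm p)\<^sup>2 = \<delta>/2 * (2 - 3*\<delta>/2)"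
          unfolding np r_def by (simp add: power2_eq_square field_simps)
        moreover have "\<delta>/2 * (2 - 3*\<delta>/2) \<le> \<delta>/2 * 2" "0 \<le> \<delta>/2 * (2 - 3*\<delta>/2)"
          using d by (intro mult_left_mono mult_nonneg_nonneg; simp)+
        ultimately show ?thesis by simp
      qed
      also have "norm p * norm (z - p) \<le> 1 * (\<delta>/64)"
        using 2 np d by (intro mult_mono) (auto simp: dist_norm norm_minus_commute)
      finally have num: "norm (of_real (r\<^sup>2) - cnj p * z) \<le> 2 * \<delta>" using d by simp
      have nz: "norm (z - p) = \<delta>/64" using 2 by (simp add: dist_norm norm_minus_commute)
      have "norm (q z) = norm (of_real (r\<^sup>2) - cnj p * z) / (r * (\<delta>/64))"
        unfolding q_def norm_divide norm_mult nz using r by simp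
      also have "\<dots> \<le> (2 * \<delta>) / (7/8 * (\<delta>/64))"
        using num r d by (intro frac_le mult_mono mult_pos_pos) auto
      also have "\<dots> \<le> 256" using d by simp
      also have "\<dots> \<le> exp (6::real)"
      proof -
        have "(13/8::real) \<le> exp (1/2)" using exp_lower_Taylor_quadratic[of "1/2::real"] by (simp add: power2_eq_square)
        then have "(13/8::real)^12 \<le> exp (1/2) ^ 12" by (intro power_mono) auto
        also have "exp (1/2::real) ^ 12 = exp 6" by (simp flip: exp_of_nat_mult)
        finally show ?thesis by (simp add: power_numeral_reduce)
      qed
      finally have "norm (q z) \<le> exp 6" .
      then have "norm (q z) ^ n \<le> exp 6 ^ n" by (intro power_mono) auto
      also have "exp (6::real) ^ n = exp (6 * real n)" by (simp flip: exp_of_nat2_mult)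
      finally have qn: "norm (q z) ^ n \<le> exp (6 * real n)" .
      have "norm (f z * q z ^ n) \<le> exp (- K) * exp (6 * real n)"
        unfolding norm_mult norm_power
        using neg[of z] 2 qn by (intro mult_mono) (auto simp: dist_commute)
      also have "\<dots> \<le> exp H" using n by (simp flip: exp_add)
      finally show ?thesis .
    qed
  qed
  \<comment> \<open>The Blaschke identity gives a difference of squares of at least
    \<open>R/4 * (\<delta>/2)\<close>, and the numerator of \<open>q v\<close> is at most
    \<open>2 * R\<close>; dividing the first by the square of the second gives
    \<open>x\<close>.\<close>
  define x where "x = \<delta>/(32*R)"
  have x: "0 < x" "x < 1" using d R by (auto simp: x_def field_simps)
  have "exp (x/2) \<le> norm (q v)"
  proof -
    define a where "a = norm (of_real (r\<^sup>2) - cnj p * v)"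
    define b where "b = r * norm (v - p)"
    have vp': "v \<noteq> p" using vp d by auto
    then have b: "b > 0" using r by (simp add: b_def)
    have "of_real (r\<^sup>2) - cnj p * v = of_real (r\<^sup>2 - (norm p)\<^sup>2) + cnj p * (p - v)"
      using complex_norm_square[of p] by (simp add: algebra_simps)
    then have "a \<le> \<bar>r\<^sup>2 - (norm p)\<^sup>2\<bar> + norm p * norm (p - v)"
      unfolding a_def by (metis complex_mod_cnj norm_mult norm_of_real norm_triangle_ineq)
    also have "\<bar>r\<^sup>2 - (norm p)\<^sup>2\<bar> \<le> \<delta>"
    proof -
      have "r\<^sup>2 - (norm p)\<^sup>2 = \<delta>/2 * (2 - 3*\<delta>/2)"
        unfolding np r_def by (simp add: power2_eq_square field_simps)
      moreover have "\<delta>/2 * (2 - 3*\<delta>/2) \<le> \<delta>/2 * 2" "0 \<le> \<delta>/2 * (2 - 3*\<delta>/2)"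
        using d by (intro mult_left_mono mult_nonneg_nonneg; simp)+
      ultimately show ?thesis by simp
    qed
    also have "norm p * norm (p - v) \<le> 1 * (R - \<delta> + R/64)"
    proof (intro mult_mono)
      have "norm (p - v) \<le> norm (p - of_real (1 - R) * u) + norm (of_real (1 - R) * u - v)"
        by (metis norm_triangle_ineq diff_add_cancel add_diff_eq)
      also have "p - of_real (1 - R) * u = of_real (R - \<delta>) * u"
        by (simp add: p_def algebra_simps)
      also have "norm (of_real (R - \<delta>) * u) = R - \<delta>"
        using d u by (simp add: norm_mult del: of_real_diff)
      finally show "norm (p - v) \<le> R - \<delta> + R/64"
        using v by (simp add: dist_norm norm_minus_commute)
    qed (use np d in auto)
    finally have a2: "a \<le> 2 * R" using R by simp
    have e1: "\<delta>/2 \<le> r\<^sup>2 - (norm p)\<^sup>2"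
    proof -
      have "r\<^sup>2 - (norm p)\<^sup>2 = \<delta>/2 * (2 - 3*\<delta>/2)"
        unfolding np r_def by (simp add: power2_eq_square field_simps)
      moreover have "\<delta>/2 * 1 \<le> \<delta>/2 * (2 - 3*\<delta>/2)"
        using d by (intro mult_left_mono) auto
      ultimately show ?thesis by simp
    qed
    have e2: "R/4 \<le> r\<^sup>2 - (norm v)\<^sup>2"
    proof -
      have "R * (31/64) * (7/8) \<le> (r - norm v) * (r + norm v)"
      proof -
        have "R * (31/64) \<le> r - norm v" using nv d by (simp add: r_def)
        moreover have "7/8 \<le> r + norm v" using r norm_ge_zero[of v] by linarith
        ultimately show ?thesis using R by (intro mult_mono) auto
      qed
      then show ?thesis using R by (simp add: power2_eq_square algebra_simps)
    qed
    have "R/4 * (\<delta>/2) \<le> a\<^sup>2 - b\<^sup>2"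
    proof -
      have "R/4 * (\<delta>/2) \<le> (r\<^sup>2 - (norm v)\<^sup>2) * (r\<^sup>2 - (norm p)\<^sup>2)"
        using e1 e2 R d by (intro mult_mono) auto
      also have "\<dots> = a\<^sup>2 - b\<^sup>2"
        using blaschke_norm_identity[of r p v] by (simp add: a_def b_def power_mult_distrib)
      finally show ?thesis .
    qed
    moreover have "x * a\<^sup>2 \<le> R/4 * (\<delta>/2)"
    proof -
      have "a\<^sup>2 \<le> (2*R)\<^sup>2" using a2 by (intro power_mono) (auto simp: a_def)
      then have "x * a\<^sup>2 \<le> x * (2*R)\<^sup>2" using x by (intro mult_left_mono) auto
      also have "\<dots> = R/4 * (\<delta>/2)" using R by (simp add: x_def power2_eq_square field_simps)
      finally show ?thesis .
    qed
    ultimately have "b\<^sup>2 \<le> (1 - x) * a\<^sup>2" by (simp add: algebra_simps)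
    also have "\<dots> \<le> exp (-x) * a\<^sup>2"
      using exp_ge_add_one_self[of "-x"] by (intro mult_right_mono) auto
    finally have "exp x * b\<^sup>2 \<le> a\<^sup>2" by (simp add: exp_minus field_simps)
    moreover have "exp x = (exp (x/2))\<^sup>2" by (simp add: power2_eq_square flip: exp_add)
    ultimately have "(exp (x/2) * b)\<^sup>2 \<le> a\<^sup>2" by (simp add: power_mult_distrib)
    then have "exp (x/2) * b \<le> a" by (rule power2_le_imp_le) (simp add: a_def)
    then have "exp (x/2) \<le> a / b" using b by (simp add: field_simps)
    also have "a / b = norm (q v)" using r by (simp add: a_def b_def q_def norm_divide norm_mult)
    finally show ?thesis .
  qed
  then have "exp (x/2) ^ n \<le> norm (q v) ^ n" by (intro power_mono) auto
  moreover have "exp (x/2) ^ n = exp (real n * (x/2))" by (rule exp_of_nat_mult[symmetric])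
  ultimately have "exp (- H') * exp (real n * (x/2)) \<le> norm (f v) * norm (q v) ^ n"
    using v by (intro mult_mono) auto
  also have "\<dots> \<le> exp H" using \<open>norm (f v * q v ^ n) \<le> exp H\<close> by (simp add: norm_mult norm_power)
  finally have "real n * (x/2) \<le> H + H'" by (simp flip: exp_add)
  then have "real n \<le> 64 * (R/\<delta>) * (H + H')" using d R by (simp add: x_def field_simps)
  \<comment> \<open>The choice of \<open>n\<close> gives \<open>K < 6 * real n + 6\<close>, and 6
    times 64 is 384; the constant 400 in \<open>K\<close> leaves room for the summand 6 because
    \<open>1 \<le> R/\<delta>\<close>.\<close>
  then have "K < 384 * (R/\<delta>) * (H + H') + 6" using n H by simp
  moreover have "K = 384 * (R/\<delta>) * (H + H') + 16 * ((R/\<delta>) * (H + H')) + 400 * (R/\<delta>)"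
  proof -
    have "400 * X * (Y + 1) = 384 * X * Y + 16 * (X * Y) + 400 * X" for X Y :: real by algebra
    then show ?thesis unfolding K_def .
  qed
  moreover have "0 \<le> (R/\<delta>) * (H + H')" using d R H by simp
  ultimately show False using X1 by linarith
qed

text \<open>One propagation step from scale \<open>N \<delta>\<close> to \<open>\<delta>\<close> loses a factor \<open>400 N\<close> but the target \<open>C \<delta>\<^bsup>-\<sigma>\<^esup>\<close> gains
\<open>N\<^bsup>\<sigma>\<^esup>\<close>; this is where \<open>\<sigma> > 1\<close> is needed.\<close>

lemma lower_bound_iterate:
  fixes f :: "complex \<Rightarrow> complex"
  assumes holf: "f holomorphic_on ball 0 1" and \<sigma>: "1 < \<sigma>"
    and R1: "0 < R1" "R1 \<le> 1/4" and hm: "0 \<le> h" "0 \<le> m"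
    and H: "\<And>\<delta> z. 0 < \<delta> \<Longrightarrow> \<delta> \<le> R1 \<Longrightarrow> norm z \<le> 1 - \<delta>/2 \<Longrightarrow>
              norm (f z) \<le> exp (h * \<delta> powr (- \<sigma>))"
    and base: "\<And>u. norm u = 1 \<Longrightarrow> exp (- m) \<le> norm (f (of_real (1 - R1) * u))"
  shows "\<exists>C\<ge>0. \<forall>\<delta> u. 0 < \<delta> \<longrightarrow> \<delta> \<le> R1 \<longrightarrow> norm u = 1 \<longrightarrow>
           (\<exists>w. dist w (of_real (1 - \<delta>) * u) \<le> \<delta>/64 \<and> exp (- (C * \<delta> powr (- \<sigma>))) \<le> norm (f w))"
proof -
  \<comment> \<open>Solves \<open>400 * N * N powr (- \<sigma>) = 1/2\<close>: the bound inherited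
    from the larger scale uses up half of the target, and \<open>C\<close> is chosen so that the
    other half covers \<open>h\<close> and the constant terms.\<close>
  define N where "N = 800 powr (1/(\<sigma> - 1))"
  have "800 powr 0 < N" unfolding N_def using \<sigma> by (intro powr_less_mono) auto
  then have N1: "1 < N" by simp
  have NN: "N powr (1 - \<sigma>) = 1/800"
  proof -
    have "N powr (1 - \<sigma>) = 800 powr ((1/(\<sigma> - 1)) * (1 - \<sigma>))"
      unfolding N_def by (rule powr_powr)
    also have "(1/(\<sigma> - 1)) * (1 - \<sigma>) = -1" using \<sigma> by (simp add: field_simps)
    finally show ?thesis by (simp add: powr_minus)
  qed
  define C where "C = 800 * N * (h + m + 1)"
  have C0: "0 \<le> C" using hm N1 by (simp add: C_def)
  let ?P = "\<lambda>\<delta> u. \<exists>w. dist w (of_real (1 - \<delta>) * u) \<le> \<delta>/64 \<and> exp (- (C * \<delta> powr (- \<sigma>))) \<le> norm (f w)"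
  have near: "?P \<delta> u" if "0 < \<delta>" "\<delta> \<le> R1" "R1 \<le> N * \<delta>" "norm u = 1" for \<delta> u
  proof -
    define D where "D = \<delta> powr (- \<sigma>)"
    have D: "1 \<le> D"
      using that R1 \<sigma> unfolding D_def powr_minus
      by (intro one_le_inverse powr_le1) auto
    have "\<exists>w. dist w (of_real (1 - \<delta>) * u) \<le> \<delta>/64
             \<and> exp (- (400 * (R1/\<delta>) * (h * D + m + 1))) \<le> norm (f w)"
      unfolding D_def
      by (rule lower_bound_propagation[OF holf \<open>norm u = 1\<close>, where v = "of_real (1 - R1) * u"])
         (use that R1 hm base H in auto)
    moreover have "400 * (R1/\<delta>) * (h * D + m + 1) \<le> C * D"
    proof -
      have "400 * (R1/\<delta>) * (h * D + m + 1) \<le> (400 * N) * (h * D + m * D + 1 * D)"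
        using that hm D R1 N1 mult_left_mono[OF D, of m] by (intro mult_mono) (auto simp: field_simps)
      also have "\<dots> = C/2 * D" by (simp add: C_def algebra_simps)
      also have "\<dots> \<le> C * D" using C0 D by simp
      finally show ?thesis .
    qed
    ultimately show ?thesis unfolding D_def
      by (meson exp_le_cancel_iff neg_le_iff_le order_trans)
  qed
  \<comment> \<open>Here \<open>n\<close> bounds the number of steps of ratio \<open>N\<close> that
    lead from \<open>\<delta>\<close> up to \<open>R1\<close>; the last of them is
    \<open>near\<close>, which starts on the circle where \<open>f\<close> is bounded below.\<close>
  have far: "?P \<delta> u" if "R1 \<le> N ^ n * \<delta>" "0 < \<delta>" "\<delta> \<le> R1" "norm u = 1" for n \<delta> u
    using that
  proof (induction n arbitrary: \<delta>)
    case 0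
    have "\<delta> \<le> N * \<delta>" using 0 N1 by simp
    with 0 show ?case by (intro near) auto
  next
    case (Suc n)
    show ?case
    proof (cases "R1 \<le> N * \<delta>")
      case True
      with Suc show ?thesis by (intro near) auto
    next
      case False
      define R where "R = N * \<delta>"
      have R: "0 < R" "R \<le> R1" "\<delta> \<le> R" using False Suc N1 by (auto simp: R_def)
      obtain v where v: "dist v (of_real (1 - R) * u) \<le> R/64" "exp (- (C * R powr (- \<sigma>))) \<le> norm (f v)"
        using Suc.IH[of R] R Suc.prems by (auto simp: R_def mult_ac)
      define D where "D = \<delta> powr (- \<sigma>)"
      have D: "1 \<le> D"
        using Suc R1 \<sigma> unfolding D_def powr_minus
        by (intro one_le_inverse powr_le1) auto
      have "\<exists>w. dist w (of_real (1 - \<delta>) * u) \<le> \<delta>/64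
             \<and> exp (- (400 * (R/\<delta>) * (h * D + C * R powr (- \<sigma>) + 1))) \<le> norm (f w)"
        unfolding D_def
        by (rule lower_bound_propagation[OF holf \<open>norm u = 1\<close> _ _ _ _ _ _ v])
           (use Suc R R1 hm C0 H in auto)
      moreover have "400 * (R/\<delta>) * (h * D + C * R powr (- \<sigma>) + 1) \<le> C * D"
      proof -
        have "R powr (- \<sigma>) = N powr (- \<sigma>) * D"
          using N1 Suc by (simp add: R_def D_def powr_mult)
        moreover have "N * N powr (- \<sigma>) = 1/800"
          using NN N1 powr_add[of N 1 "-\<sigma>"] by simp
        ultimately have "N * (C * R powr (- \<sigma>)) = C * D / 800" by (simp add: mult_ac)
        moreover have "R/\<delta> = N" using Suc by (simp add: R_def)
        ultimately have "400 * (R/\<delta>) * (h * D + C * R powr (- \<sigma>) + 1)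
            = 400 * N * (h * D + 1) + C * D / 2" by (simp add: algebra_simps)
        also have "\<dots> \<le> 400 * N * ((h + m + 1) * D) + C * D / 2"
        proof (intro add_right_mono mult_left_mono)
          have "0 \<le> m * D" using hm D by simp
          then have "1 \<le> (m + 1) * D" using D unfolding distrib_right by linarith
          then show "h * D + 1 \<le> (h + m + 1) * D" by (simp add: algebra_simps)
        qed (use N1 in auto)
        also have "\<dots> = C * D" by (simp add: C_def algebra_simps)
        finally show ?thesis .
      qed
      ultimately show ?thesis unfolding D_def
        by (meson exp_le_cancel_iff neg_le_iff_le order_trans)
    qed
  qed
  have "?P \<delta> u" if "0 < \<delta>" "\<delta> \<le> R1" "norm u = 1" for \<delta> u
  proof -
    obtain n where "R1/\<delta> < N ^ n" using real_arch_pow[OF N1] by blast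
    then have "R1 \<le> N ^ n * \<delta>" using that by (simp add: field_simps)
    then show ?thesis using that by (rule far)
  qed
  with C0 show ?thesis by blast
qed

text \<open>The starting scale \<open>\<delta> powr (s/\<sigma>)\<close> is the one where the
  general lower bound, with exponent \<open>C * R powr (- \<sigma>)\<close>, balances the upper
  bound \<open>h * \<delta> powr (- s)\<close> valid at scale \<open>\<delta>\<close>. The loss
  factor \<open>R/\<delta>\<close> is then \<open>\<delta> powr (s/\<sigma> - 1)\<close>, less than
  the 1/\<delta> that a descent from a fixed scale would cost.\<close>

lemma lower_bound_two_scales:
  fixes f :: "complex \<Rightarrow> complex"
  assumes holf: "f holomorphic_on ball 0 1" and u: "norm u = 1"
    and s: "0 < s" "s \<le> \<sigma>" and R1: "R1 \<le> 1/4" and C: "0 \<le> C" "0 \<le> h"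
    and low: "\<And>R. 0 < R \<Longrightarrow> R \<le> R1 \<Longrightarrow>
       \<exists>v. dist v (of_real (1 - R) * u) \<le> R/64 \<and> exp (- (C * R powr (- \<sigma>))) \<le> norm (f v)"
    and d: "0 < \<delta>" "\<delta> powr (s/\<sigma>) \<le> R1"
    and H: "\<And>z. norm z \<le> 1 - \<delta>/2 \<Longrightarrow> norm (f z) \<le> exp (h * \<delta> powr (- s))"
  shows "\<exists>w. dist w (of_real (1 - \<delta>) * u) \<le> \<delta>/64 \<and>
           exp (- (400 * (h + C + 1) * \<delta> powr (- (s + 1 - s/\<sigma>)))) \<le> norm (f w)"
proof -
  define R where "R = \<delta> powr (s/\<sigma>)"
  have R: "0 < R" "R \<le> R1" using d by (auto simp: R_def)
  have d1: "\<delta> < 1"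
  proof (rule ccontr)
    assume "\<not> \<delta> < 1"
    then have "1 \<le> R" unfolding R_def using s by (intro ge_one_powr_ge_zero) auto
    then show False using R R1 by simp
  qed
  have dR: "\<delta> \<le> R"
  proof -
    have "\<delta> powr 1 \<le> \<delta> powr (s/\<sigma>)" using d d1 s by (intro powr_mono') auto
    then show ?thesis using d by (simp add: R_def)
  qed
  have Rs: "R powr (- \<sigma>) = \<delta> powr (- s)" using s by (simp add: R_def powr_powr)
  obtain v where v: "dist v (of_real (1 - R) * u) \<le> R/64" "exp (- (C * R powr (- \<sigma>))) \<le> norm (f v)"
    using low R by blast
  have "\<exists>w. dist w (of_real (1 - \<delta>) * u) \<le> \<delta>/64
     \<and> exp (- (400 * (R/\<delta>) * (h * \<delta> powr (- s) + C * R powr (- \<sigma>) + 1))) \<le> norm (f w)"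
    by (rule lower_bound_propagation[OF holf u _ _ _ _ _ _ v])
       (use d R R1 C H dR in auto)
  moreover have "400 * (R/\<delta>) * (h * \<delta> powr (- s) + C * R powr (- \<sigma>) + 1)
      \<le> 400 * (h + C + 1) * \<delta> powr (- (s + 1 - s/\<sigma>))"
  proof -
    have "1 \<le> \<delta> powr (- s)"
      using d d1 s unfolding powr_minus by (intro one_le_inverse powr_le1) auto
    then have "400 * (R/\<delta>) * (h * \<delta> powr (- s) + C * R powr (- \<sigma>) + 1)
        \<le> 400 * (R/\<delta>) * ((h + C + 1) * \<delta> powr (- s))"
      unfolding Rs using R d by (intro mult_left_mono) (auto simp: algebra_simps)
    also have "400 * (R/\<delta>) * ((h + C + 1) * \<delta> powr (- s)) = 400 * \<delta> powr (s/\<sigma> - 1) * ((h + C + 1) * \<delta> powr (- s))"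
      using d by (simp add: R_def powr_diff)
    also have "\<dots> = 400 * (h + C + 1) * (\<delta> powr (s/\<sigma> - 1) * \<delta> powr (- s))" by simp
    also have "\<delta> powr (s/\<sigma> - 1) * \<delta> powr (- s) = \<delta> powr (- (s + 1 - s/\<sigma>))"
      by (simp flip: powr_add) (simp add: algebra_simps)
    finally show ?thesis .
  qed
  ultimately show ?thesis
    by (meson exp_le_cancel_iff neg_le_iff_le order_trans)
qed

section \<open>A local bound for the coefficient\<close>

lemma harnack_Re:
  fixes G :: "complex \<Rightarrow> complex"
  assumes hol: "G holomorphic_on ball c r" and pos: "\<And>z. z \<in> ball c r \<Longrightarrow> 0 < Re (G z)"
    and \<zeta>: "\<zeta> \<in> ball c r"
  shows "\<bar>Re (G \<zeta>) - Re (G c)\<bar> \<le> dist \<zeta> c / r * (Re (G \<zeta>) + Re (G c))"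
proof -
  have r: "0 < r" using \<zeta> by (metis ball_eq_empty empty_iff not_le)
  have inb: "c + of_real r * y \<in> ball c r" if "norm y < 1" for y
    using that r by (simp add: dist_norm norm_mult)
  define F where "F = (\<lambda>y. (G (c + of_real r * y) - G c) / (G (c + of_real r * y) + cnj (G c)))"
  define y where "y = (\<zeta> - c) / of_real r"
  have y: "norm y < 1" "c + of_real r * y = \<zeta>"
    using \<zeta> r by (simp_all add: y_def norm_divide dist_norm norm_minus_commute)
  have Gc: "0 < Re (G c)" using r by (intro pos) auto
  have nz: "G (c + of_real r * y) + cnj (G c) \<noteq> 0" if "norm y < 1" for y
  proof -
    have "0 < Re (G (c + of_real r * y) + cnj (G c))"
      using pos[OF inb[OF that]] Gc by simp
    then show ?thesis by force
  qed
  have norm_sq: "(norm (a + cnj b))\<^sup>2 - (norm (a - b))\<^sup>2 = 4 * Re a * Re b" for a b :: complex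
    by (simp only: cmod_power2) (simp add: power2_eq_square algebra_simps)
  have "norm (F y) \<le> norm y"
  proof (rule Schwarz_Lemma(1))
    have "(\<lambda>y. c + of_real r * y) holomorphic_on ball 0 1" by (intro holomorphic_intros)
    then have "(G \<circ> (\<lambda>y. c + of_real r * y)) holomorphic_on ball 0 1"
      by (rule holomorphic_on_compose_gen[OF _ hol]) (use inb in auto)
    then have "(\<lambda>y. G (c + of_real r * y)) holomorphic_on ball 0 1" by (simp add: o_def)
    then show "F holomorphic_on ball 0 1"
      unfolding F_def by (intro holomorphic_intros) (use nz in auto)
    show "F 0 = 0" by (simp add: F_def)
    show "norm (F z) < 1" if "norm z < 1" for z
    proof -
      let ?a = "G (c + of_real r * z)"
      have "0 < 4 * Re ?a * Re (G c)" using pos[OF inb[OF that]] Gc by simp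
      then have "(norm (?a - G c))\<^sup>2 < (norm (?a + cnj (G c)))\<^sup>2" using norm_sq[of ?a "G c"] by linarith
      then have "norm (?a - G c) < norm (?a + cnj (G c))" by (rule power2_less_imp_less) simp
      then show ?thesis using nz[OF that] by (simp add: F_def norm_divide)
    qed
  qed (use y in auto)
  then have "norm (G \<zeta> - G c) \<le> norm y * norm (G \<zeta> + cnj (G c))"
    using nz[OF y(1)] y by (simp add: F_def norm_divide field_simps)
  then have "(norm (G \<zeta> - G c))\<^sup>2 \<le> (norm y)\<^sup>2 * (norm (G \<zeta> + cnj (G c)))\<^sup>2"
    by (metis norm_ge_zero power_mono power_mult_distrib)
  then have "(Re (G \<zeta>) - Re (G c))\<^sup>2 + (Im (G \<zeta>) - Im (G c))\<^sup>2
      \<le> (norm y)\<^sup>2 * (Re (G \<zeta>) + Re (G c))\<^sup>2 + (norm y)\<^sup>2 * (Im (G \<zeta>) - Im (G c))\<^sup>2"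
    by (simp add: cmod_power2 distrib_left)
  moreover have "(norm y)\<^sup>2 * (Im (G \<zeta>) - Im (G c))\<^sup>2 \<le> 1 * (Im (G \<zeta>) - Im (G c))\<^sup>2"
    using y by (intro mult_right_mono) (auto simp: power_le_one_iff)
  ultimately have "\<bar>Re (G \<zeta>) - Re (G c)\<bar>\<^sup>2 \<le> (norm y * (Re (G \<zeta>) + Re (G c)))\<^sup>2"
    by (simp add: power_mult_distrib)
  then have "\<bar>Re (G \<zeta>) - Re (G c)\<bar> \<le> norm y * (Re (G \<zeta>) + Re (G c))"
    by (rule power2_le_imp_le) (use pos[OF \<zeta>] Gc in auto)
  then show ?thesis using r by (simp add: y_def norm_divide dist_norm)
qed

text \<open>Harnack's inequality is applied twice to the harmonic function L + 1 - log |g|, where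
  the summand 1 makes it strictly positive. It is at most L + K + 1 at \<open>w\<close>; moving to
  \<open>z\<close> across half of the radius costs a factor 3, and around \<open>z\<close> the
  change is linear in \<open>dist \<zeta> z\<close>. With radius \<open>\<rho>/4\<close> the
  constant becomes 2 * 3 * 4 = 24.\<close>

lemma zero_free_local_growth:
  assumes hol: "g holomorphic_on ball w (\<rho>/2)" and nz: "\<And>z. z \<in> ball w (\<rho>/2) \<Longrightarrow> g z \<noteq> 0"
    and L: "\<And>z. z \<in> ball w (\<rho>/2) \<Longrightarrow> norm (g z) \<le> exp L" and K: "exp (- K) \<le> norm (g w)"
    and z: "dist z w \<le> \<rho>/4" "dist \<zeta> z < \<rho>/4"
  shows "norm (g \<zeta>) \<le> exp (24 * (L + K + 1) * dist \<zeta> z / \<rho>) * norm (g z)"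
proof -
  have \<rho>: "0 < \<rho>" using z(2) by (smt (verit) zero_le_dist divide_nonpos_pos)
  obtain h where h: "h holomorphic_on ball w (\<rho>/2)" "\<And>z. z \<in> ball w (\<rho>/2) \<Longrightarrow> g z = exp (h z)"
    using contractible_imp_holomorphic_log[OF hol convex_imp_contractible[OF convex_ball] nz] by blast
  define G where "G = (\<lambda>z. of_real (L + 1) - h z)"
  have G: "G holomorphic_on ball w (\<rho>/2)" unfolding G_def using h(1) by (intro holomorphic_intros)
  have ng: "norm (g z) = exp (L + 1 - Re (G z))" if "z \<in> ball w (\<rho>/2)" for z
    using h(2)[OF that] by (simp add: G_def)
  have pos: "0 < Re (G z)" if "z \<in> ball w (\<rho>/2)" for z
  proof -
    have "exp (L + 1 - Re (G z)) \<le> exp L" using ng[OF that] L[OF that] by simp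
    then show ?thesis by simp
  qed
  have Gw: "Re (G w) \<le> L + K + 1"
  proof -
    have "exp (- K) \<le> exp (L + 1 - Re (G w))" using ng[of w] K \<rho> by simp
    then show ?thesis by simp
  qed
  have zb: "z \<in> ball w (\<rho>/2)" using z \<rho> by (simp add: dist_commute)
  have sub: "ball z (\<rho>/4) \<subseteq> ball w (\<rho>/2)"
  proof
    fix y assume "y \<in> ball z (\<rho>/4)"
    then show "y \<in> ball w (\<rho>/2)" using z dist_triangle[of w y z] by (simp add: dist_commute)
  qed
  have zb': "\<zeta> \<in> ball z (\<rho>/4)" using z by (simp add: dist_commute)
  have Gz: "Re (G z) \<le> 3 * (L + K + 1)"
  proof -
    have "\<bar>Re (G z) - Re (G w)\<bar> \<le> dist z w / (\<rho>/2) * (Re (G z) + Re (G w))"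
      by (rule harnack_Re[OF G pos zb])
    also have "\<dots> \<le> (1/2) * (Re (G z) + Re (G w))"
      using z \<rho> pos[OF zb] pos[of w] by (intro mult_right_mono) (auto simp: field_simps)
    finally show ?thesis using Gw by (simp add: abs_if split: if_splits)
  qed
  define \<tau> where "\<tau> = dist \<zeta> z / (\<rho>/4)"
  have "\<bar>Re (G \<zeta>) - Re (G z)\<bar> \<le> dist \<zeta> z / (\<rho>/4) * (Re (G \<zeta>) + Re (G z))"
    by (rule harnack_Re[OF holomorphic_on_subset[OF G sub] _ zb']) (use pos sub in auto)
  then have step: "Re (G z) - Re (G \<zeta>) \<le> \<tau> * (Re (G \<zeta>) + Re (G z))"
    unfolding \<tau>_def by linarith
  have \<tau>: "0 \<le> \<tau>" "\<tau> < 1" using z \<rho> by (auto simp: \<tau>_def)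
  have "Re (G z) - Re (G \<zeta>) \<le> \<tau> * (2 * (3 * (L + K + 1)))"
  proof (cases "Re (G \<zeta>) \<le> Re (G z)")
    case True
    then have "\<tau> * (Re (G \<zeta>) + Re (G z)) \<le> \<tau> * (2 * (3 * (L + K + 1)))"
      using Gz \<tau> by (intro mult_left_mono) auto
    with step show ?thesis by linarith
  next
    case False
    have "0 \<le> \<tau> * (2 * (3 * (L + K + 1)))" using Gz pos[OF zb] \<tau> by (intro mult_nonneg_nonneg) auto
    with False show ?thesis by linarith
  qed
  also have "\<tau> * (2 * (3 * (L + K + 1))) = 24 * (L + K + 1) * dist \<zeta> z / \<rho>"
    by (simp add: \<tau>_def)
  finally have "L + 1 - Re (G \<zeta>) \<le> 24 * (L + K + 1) * dist \<zeta> z / \<rho> + (L + 1 - Re (G z))" by simp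
  then show ?thesis using ng[OF zb] ng[of \<zeta>] zb' sub by (simp flip: exp_add add: subset_eq)
qed

text \<open>A form of Jensen's zero count by division. On the circle of radius
  \<open>2*\<rho>\<close> each factor (z - a i)/\<rho> has modulus at least 1, so the quotient keeps
  the upper bound; at \<open>w\<close> each factor is at most 1/2 in modulus, so the quotient gains
  a factor 2 per zero. Together this bounds \<open>n\<close>, with multiplicities counted, and a
  maximal factorisation leaves no zero in \<open>cball w (\<rho>/2)\<close>.\<close>

lemma factor_out_zeros:
  fixes f :: "complex \<Rightarrow> complex"
  assumes hol: "f holomorphic_on T" and T: "open T" "cball w (2*\<rho>) \<subseteq> T" and \<rho>: "0 < \<rho>"
    and L: "\<And>z. z \<in> cball w (2*\<rho>) \<Longrightarrow> norm (f z) \<le> exp L" and K: "exp (- K) \<le> norm (f w)"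
  obtains n :: nat and a g where "g holomorphic_on T" "\<And>i. i < n \<Longrightarrow> dist (a i) w \<le> \<rho>/2"
    "\<And>z. z \<in> T \<Longrightarrow> f z = (\<Prod>i<n. (z - a i) / of_real \<rho>) * g z"
    "\<And>z. z \<in> cball w (\<rho>/2) \<Longrightarrow> g z \<noteq> 0"
    "\<And>z. z \<in> cball w (2*\<rho>) \<Longrightarrow> norm (g z) \<le> exp L" "exp (- K) \<le> norm (g w)"
    "real n * ln 2 \<le> L + K"
proof -
  define Q where "Q = (\<lambda>(n::nat) a g. g holomorphic_on T \<and> (\<forall>i<n. dist (a i) w \<le> \<rho>/2)
      \<and> (\<forall>z\<in>T. f z = (\<Prod>i<n. (z - a i) / of_real \<rho>) * g z))"
  have bound: "norm (g z) \<le> exp L" if "Q n a g" "z \<in> cball w (2*\<rho>)" for n a g z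
  proof (rule maximum_modulus_frontier[where S = "cball w (2*\<rho>)" and f = g])
    show "g holomorphic_on interior (cball w (2*\<rho>))"
      using that T interior_subset by (meson Q_def holomorphic_on_subset order_trans)
    show "continuous_on (closure (cball w (2*\<rho>))) g"
      using that T by (auto simp: Q_def intro: holomorphic_on_subset holomorphic_on_imp_continuous_on)
    fix z assume "z \<in> frontier (cball w (2*\<rho>))"
    then have z: "dist w z = 2*\<rho>" using \<rho> by (simp add: frontier_cball)
    then have zT: "z \<in> T" "z \<in> cball w (2*\<rho>)" using T by auto
    have "1 \<le> (\<Prod>i<n. norm ((z - a i) / of_real \<rho>))"
    proof (rule prod_ge_1)
      fix i assume "i \<in> {..<n}"
      then have "dist (a i) w \<le> \<rho>/2" using that by (auto simp: Q_def)
      moreover have "dist w z \<le> dist (a i) w + dist (a i) z" by (metis dist_commute dist_triangle)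
      ultimately have "\<rho> \<le> norm (z - a i)" using z \<rho> by (simp add: dist_norm norm_minus_commute)
      then show "1 \<le> norm ((z - a i) / of_real \<rho>)" using \<rho> by (simp add: norm_divide)
    qed
    then have "norm (g z) \<le> norm (f z)"
      using that zT by (simp add: Q_def norm_mult prod_norm mult_le_cancel_right1)
    then show "norm (g z) \<le> exp L" using L[OF zT(2)] by simp
  qed (use that in auto)
  have low: "2 ^ n * exp (- K) \<le> norm (g w)" if "Q n a g" for n a g
  proof -
    have wT: "w \<in> T" using T \<rho> by auto
    have "norm (\<Prod>i<n. (w - a i) / of_real \<rho>) \<le> (\<Prod>i<n. 1/2)"
      unfolding prod_norm[symmetric]
    proof (rule prod_mono, safe)
      fix i assume "i < n"
      then have "dist (a i) w \<le> \<rho>/2" using that by (auto simp: Q_def)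
      then show "norm ((w - a i) / of_real \<rho>) \<le> 1/2"
        using \<rho> by (simp add: norm_divide dist_norm norm_minus_commute field_simps)
    qed simp
    then have "norm (f w) \<le> (1/2) ^ n * norm (g w)"
      using that wT by (simp add: Q_def norm_mult mult_right_mono)
    then have "exp (- K) \<le> (1/2) ^ n * norm (g w)" using K by simp
    then show ?thesis by (simp add: field_simps power_divide)
  qed
  have count: "real n * ln 2 \<le> L + K" if "Q n a g" for n a g
  proof -
    have "2 ^ n * exp (- K) \<le> exp L" using low[OF that] bound[OF that, of w] \<rho> by simp
    moreover have "(2::real) ^ n = exp (real n * ln 2)" by (simp add: exp_of_nat_mult)
    ultimately show ?thesis by (simp flip: exp_add)
  qed
  have bdd: "\<forall>n. (\<exists>a g. Q n a g) \<longrightarrow> n \<le> nat \<lceil>(L + K) / ln 2\<rceil>"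
  proof (intro allI impI)
    fix n assume "\<exists>a g. Q n a g"
    then have "real n * ln 2 \<le> L + K" using count by blast
    then have "real n \<le> (L + K) / ln 2" by (simp add: field_simps)
    then show "n \<le> nat \<lceil>(L + K) / ln 2\<rceil>" by linarith
  qed
  have "Q 0 a f" for a using hol by (simp add: Q_def)
  then have ex: "\<exists>n. \<exists>a g. Q n a g" by blast
  define n where "n = (GREATEST n. \<exists>a g. Q n a g)"
  have "\<exists>a g. Q n a g" unfolding n_def
    by (rule GreatestI_ex_nat[where b = "nat \<lceil>(L + K) / ln 2\<rceil>"]) (use ex bdd in blast)+
  then obtain a g where Q: "Q n a g" by blast
  have max: "m \<le> n" if "Q m a g" for m a g unfolding n_def
    by (rule Greatest_le_nat[where b = "nat \<lceil>(L + K) / ln 2\<rceil>"]) (use that bdd in blast)+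
  have nz: "g b \<noteq> 0" if b: "b \<in> cball w (\<rho>/2)" for b
  proof
    assume "g b = 0"
    \<comment> \<open>A remaining zero could be divided out, since the singularity of the quotient
      is removable; this contradicts maximality. The factor \<open>of_real \<rho>\<close> in front
      of \<open>g1\<close> restores the normalisation.\<close>
    define g1 where "g1 = (\<lambda>z. if z = b then deriv g b else (g z - g b) / (z - b))"
    have hol1: "g1 holomorphic_on T"
      unfolding g1_def using Q T by (intro pole_lemma_open) (auto simp: Q_def)
    have g1: "g z = (z - b) * g1 z" for z using \<open>g b = 0\<close> by (simp add: g1_def)
    have "Q (Suc n) (a(n := b)) (\<lambda>z. of_real \<rho> * g1 z)"
      unfolding Q_def
    proof (intro conjI ballI allI impI)
      show "(\<lambda>z. of_real \<rho> * g1 z) holomorphic_on T" using hol1 by (intro holomorphic_intros)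
      show "dist ((a(n := b)) i) w \<le> \<rho>/2" if "i < Suc n" for i
        using that b Q by (auto simp: Q_def less_Suc_eq dist_commute)
      fix z assume z: "z \<in> T"
      have "(\<Prod>i<Suc n. (z - (a(n := b)) i) / of_real \<rho>) = (\<Prod>i<n. (z - a i) / of_real \<rho>) * ((z - b) / of_real \<rho>)"
        by simp
      moreover have "f z = (\<Prod>i<n. (z - a i) / of_real \<rho>) * ((z - b) * g1 z)"
        using Q z g1[of z] by (simp add: Q_def)
      ultimately show "f z = (\<Prod>i<Suc n. (z - (a(n := b)) i) / of_real \<rho>) * (of_real \<rho> * g1 z)"
        using \<rho> by simp
    qed
    from max[OF this] show False by simp
  qed
  have "exp (- K) \<le> 2 ^ n * exp (- K)" by simp
  also have "\<dots> \<le> norm (g w)" using low[OF Q] .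
  finally have "exp (- K) \<le> norm (g w)" .
  with Q nz bound[OF Q] count[OF Q] show ?thesis
    by (intro that[of g n a]) (auto simp: Q_def)
qed

text \<open>Each \<open>y i\<close> is at most the total, so \<open>y i powr c\<close> is at most
  \<open>y i\<close> times the total to the power \<open>c - 1\<close>. This is what converts a
  bound for the exponent \<alpha> into one for the exponent 1.\<close>

lemma sum_powr_le_powr_sum:
  fixes y :: "'a \<Rightarrow> real"
  assumes "finite I" "\<And>i. i \<in> I \<Longrightarrow> 0 \<le> y i" "1 \<le> c"
  shows "(\<Sum>i\<in>I. y i powr c) \<le> (\<Sum>i\<in>I. y i) powr c"
proof -
  define Y where "Y = (\<Sum>i\<in>I. y i)"
  have Y: "0 \<le> Y" unfolding Y_def using assms by (intro sum_nonneg) auto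
  have split: "x powr c = x * x powr (c - 1)" if "0 \<le> x" for x :: real
    using that by (cases "x = 0") (auto simp: powr_diff)
  have "(\<Sum>i\<in>I. y i powr c) \<le> (\<Sum>i\<in>I. y i * Y powr (c - 1))"
  proof (rule sum_mono)
    fix i assume i: "i \<in> I"
    have "y i \<le> Y" unfolding Y_def using assms i by (intro member_le_sum) auto
    then have "y i powr (c - 1) \<le> Y powr (c - 1)" using assms i by (intro powr_mono2) auto
    then show "y i powr c \<le> y i * Y powr (c - 1)"
      using split[of "y i"] assms i by (simp add: mult_left_mono)
  qed
  also have "\<dots> = Y powr c" using split[OF Y] by (simp add: Y_def sum_distrib_right)
  finally show ?thesis by (simp add: Y_def)
qed

text \<open>The primitive of \<open>|t - x|\<^bsup>-\<alpha>\<^esup>\<close> is bounded for \<open>\<alpha> < 1\<close>, so the sum with exponent \<open>\<alpha>\<close> is \<open>O(n)\<close> somewhere;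
passing from \<open>\<alpha>\<close> to \<open>1\<close> costs only the power \<open>1/\<alpha>\<close>, which may be taken close to \<open>1\<close>.\<close>

lemma good_radius:
  fixes x :: "nat \<Rightarrow> real"
  assumes \<alpha>: "0 < \<alpha>" "\<alpha> < 1" and x: "\<And>i. i < n \<Longrightarrow> 0 \<le> x i \<and> x i \<le> 1"
  shows "\<exists>t. 1/8 < t \<and> t < 1/4 \<and> (\<forall>i<n. t \<noteq> x i) \<and> (\<Sum>i<n. 1 / \<bar>t - x i\<bar>) \<le> (17/(1-\<alpha>) * real n) powr (1/\<alpha>)"
proof (cases "n = 0")
  case True
  then show ?thesis by (intro exI[of _ "3/16"]) auto
next
  case False
  define \<beta> where "\<beta> = 1 - \<alpha>"
  have \<beta>: "0 < \<beta>" "\<beta> < 1" using \<alpha> by (auto simp: \<beta>_def)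
  \<comment> \<open>Over an interval of length 1/8, an integral of at most
    \<open>n * (2/\<beta>)\<close> means an average of at most 16 n/\<beta>; the constant 17 makes
    the contradiction strict.\<close>
  define B where "B = 17/\<beta>"
  define S where "S = x ` {..<n} \<union> {1/8, 1/4}"
  \<comment> \<open>The odd primitive of \<open>\<bar>y\<bar> powr (- \<alpha>)\<close>, continuous
    across the singularity of the integrand at 0.\<close>
  define g where "g = (\<lambda>y::real. (max y 0 powr \<beta> - max (- y) 0 powr \<beta>) / \<beta>)"
  have gder: "(g has_real_derivative \<bar>y\<bar> powr (- \<alpha>)) (at y)" if "y \<noteq> 0" for y
  proof (cases "0 < y")
    case True
    have "((\<lambda>y. y powr \<beta> / \<beta>) has_real_derivative \<bar>y\<bar> powr (- \<alpha>)) (at y)"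
      using True \<beta> by (auto intro!: derivative_eq_intros simp: \<beta>_def)
    then show ?thesis
      by (rule has_field_derivative_transform_within_open[of _ _ _ "{0<..}"])
         (use True in \<open>auto simp: g_def\<close>)
  next
    case False
    have "((\<lambda>y. - ((- y) powr \<beta>) / \<beta>) has_real_derivative \<bar>y\<bar> powr (- \<alpha>)) (at y)"
      using False that \<beta> by (auto intro!: derivative_eq_intros simp: \<beta>_def)
    then show ?thesis
      by (rule has_field_derivative_transform_within_open[of _ _ _ "{..<0}"])
         (use False that in \<open>auto simp: g_def\<close>)
  qed
  have gcont: "continuous_on UNIV g"
    unfolding g_def using \<beta> by (intro continuous_intros continuous_on_powr') auto
  have gbd: "\<bar>g y\<bar> \<le> 1/\<beta>" if "\<bar>y\<bar> \<le> 1" for y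
  proof -
    have "max y 0 powr \<beta> \<le> 1" "max (-y) 0 powr \<beta> \<le> 1" using that \<beta> by (auto intro!: powr_le1)
    moreover have "0 \<le> max y 0 powr \<beta>" "0 \<le> max (-y) 0 powr \<beta>" by auto
    ultimately have "\<bar>max y 0 powr \<beta> - max (-y) 0 powr \<beta>\<bar> \<le> 1" by linarith
    then show ?thesis using \<beta> by (simp add: g_def divide_right_mono)
  qed
  have "\<exists>t. 1/8 < t \<and> t < 1/4 \<and> t \<notin> S \<and> (\<Sum>i<n. \<bar>t - x i\<bar> powr (- \<alpha>)) \<le> B * n"
  proof (rule ccontr)
    assume neg: "\<not> ?thesis"
    define F where "F = (\<lambda>t. \<Sum>i<n. g (t - x i))"
    \<comment> \<open>On the finite set \<open>S\<close>, which holds the singular points and the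
      two endpoints, the value \<open>B * n\<close> is prescribed: the integral does not see it, and
      the pointwise comparison then holds on the whole interval.\<close>
    define F' where "F' = (\<lambda>t. if t \<in> S then B * n else (\<Sum>i<n. \<bar>t - x i\<bar> powr (- \<alpha>)))"
    have FI: "(F' has_integral (F (1/4) - F (1/8))) {1/8..1/4}"
    proof (rule fundamental_theorem_of_calculus_interior_strong)
      show "finite S" by (simp add: S_def)
      fix t assume t: "t \<in> {1/8<..<1/4} - S"
      have "(F has_real_derivative (\<Sum>i<n. \<bar>t - x i\<bar> powr (- \<alpha>))) (at t)"
        unfolding F_def
      proof (rule DERIV_sum)
        fix i assume "i \<in> {..<n}"
        then have "t - x i \<noteq> 0" using t by (auto simp: S_def)
        from gder[OF this]
        show "((\<lambda>t. g (t - x i)) has_real_derivative \<bar>t - x i\<bar> powr (- \<alpha>)) (at t)"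
          by (simp add: DERIV_shift[of g _ t "- x i", simplified])
      qed
      then show "(F has_vector_derivative F' t) (at t)"
        using t by (simp add: F'_def has_real_derivative_iff_has_vector_derivative)
    next
      show "continuous_on {1/8..1/4} F"
        unfolding F_def by (intro continuous_intros continuous_on_compose2[OF gcont]) auto
    qed auto
    have CI: "((\<lambda>t. B * n) has_integral (B * n * (1/8))) {1/8..1/4::real}"
      using has_integral_const_real[of "B * n" "1/8" "1/4"] by simp
    have "B * n * (1/8) \<le> F (1/4) - F (1/8)"
    proof (rule has_integral_le[OF CI FI])
      fix t :: real assume "t \<in> {1/8..1/4}"
      then have "t \<in> S \<or> 1/8 < t \<and> t < 1/4" by (auto simp: S_def)
      with neg have "t \<in> S \<or> \<not> (\<Sum>i<n. \<bar>t - x i\<bar> powr (- \<alpha>)) \<le> B * n" by blast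
      then show "B * n \<le> F' t" by (cases "t \<in> S") (simp_all add: F'_def)
    qed
    also have "\<dots> = (\<Sum>i<n. g (1/4 - x i) - g (1/8 - x i))" by (simp add: F_def sum_subtractf)
    also have "\<dots> \<le> (\<Sum>i<n. 2/\<beta>)"
    proof (rule sum_mono)
      fix i assume "i \<in> {..<n}"
      then have "\<bar>1/4 - x i\<bar> \<le> 1" "\<bar>1/8 - x i\<bar> \<le> 1" using x[of i] by auto
      from gbd[OF this(1)] gbd[OF this(2)]
      show "g (1/4 - x i) - g (1/8 - x i) \<le> 2/\<beta>" by (simp add: abs_le_iff)
    qed
    finally have "17 / \<beta> * n * (1/8) \<le> n * (2/\<beta>)" by (simp add: B_def)
    then show False using False \<beta> by (simp add: field_simps)
  qed
  then obtain t where t: "1/8 < t" "t < 1/4" "t \<notin> S" "(\<Sum>i<n. \<bar>t - x i\<bar> powr (- \<alpha>)) \<le> B * n" by blast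
  have "(\<Sum>i<n. 1 / \<bar>t - x i\<bar>) = (\<Sum>i<n. (\<bar>t - x i\<bar> powr (- \<alpha>)) powr (1/\<alpha>))"
  proof (intro sum.cong refl)
    fix i assume "i \<in> {..<n}"
    then have "0 < \<bar>t - x i\<bar>" using t(3) by (auto simp: S_def)
    moreover have "(\<bar>t - x i\<bar> powr (- \<alpha>)) powr (1/\<alpha>) = \<bar>t - x i\<bar> powr (-1)"
      using \<alpha> by (simp only: powr_powr) simp
    ultimately show "1 / \<bar>t - x i\<bar> = (\<bar>t - x i\<bar> powr (- \<alpha>)) powr (1/\<alpha>)"
      by (simp add: powr_minus_divide)
  qed
  also have "\<dots> \<le> (\<Sum>i<n. \<bar>t - x i\<bar> powr (- \<alpha>)) powr (1/\<alpha>)"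
    using \<alpha> by (intro sum_powr_le_powr_sum) auto
  also have "\<dots> \<le> (B * n) powr (1/\<alpha>)"
    using t(4) \<alpha> by (intro powr_mono2 sum_nonneg) auto
  finally show ?thesis using t by (intro exI[of _ t]) (auto simp: B_def \<beta>_def S_def)
qed

text \<open>On a circle that keeps away from the zeros, \<open>f\<close> grows by at most a factor \<open>e\<close> within distance
\<open>\<eta> = \<rho>/H\<close>, so Cauchy's inequality bounds \<open>|A| = |f\<^bsup>(k)\<^esup>/f|\<close> there; the maximum principle for \<open>A\<close> fills
the circle.\<close>

lemma local_coefficient_bound:
  fixes f A :: "complex \<Rightarrow> complex" and k :: nat
  assumes hol: "f holomorphic_on ball 0 1" and holA: "A holomorphic_on ball 0 1"
    and ode: "\<forall>z\<in>ball 0 1. (deriv ^^ k) f z + A z * f z = 0" and \<epsilon>: "0 < \<epsilon>"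
  shows "\<exists>C>0. \<forall>w \<rho> L K. 0 < \<rho> \<longrightarrow> cball w (2*\<rho>) \<subseteq> ball 0 1 \<longrightarrow> 0 \<le> L \<longrightarrow> 0 \<le> K \<longrightarrow>
      (\<forall>z\<in>cball w (2*\<rho>). norm (f z) \<le> exp L) \<longrightarrow> exp (- K) \<le> norm (f w) \<longrightarrow>
      (\<forall>z\<in>cball w (\<rho>/8). norm (A z) \<le> C * ((L + K + 1) powr (1 + \<epsilon>) / \<rho>) ^ k)"
proof -
  define \<alpha> where "\<alpha> = 1 / (1 + \<epsilon>)"
  have \<alpha>: "0 < \<alpha>" "\<alpha> < 1" "1/\<alpha> = 1 + \<epsilon>" using \<epsilon> by (auto simp: \<alpha>_def field_simps)
  define B where "B = 17/(1-\<alpha>)"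
  have B: "0 < B" using \<alpha> by (simp add: B_def)
  \<comment> \<open>The power of \<open>2 * B\<close> comes from the zeros, of which there are at
    most \<open>2 * M\<close>; the 24 comes from the zero-free factor.\<close>
  define D where "D = (2 * B) powr (1 + \<epsilon>) + 24"
  have D: "24 \<le> D" by (simp add: D_def)
  define C where "C = fact k * exp 1 * D ^ k"
  have "0 < C" using D by (simp add: C_def)
  moreover have "norm (A z0) \<le> C * ((L + K + 1) powr (1 + \<epsilon>) / \<rho>) ^ k"
    if \<rho>: "0 < \<rho>" and sub: "cball w (2*\<rho>) \<subseteq> ball 0 1" and LK: "0 \<le> L" "0 \<le> K"
      and fL: "\<forall>z\<in>cball w (2*\<rho>). norm (f z) \<le> exp L" and fK: "exp (- K) \<le> norm (f w)"
      and z0: "z0 \<in> cball w (\<rho>/8)" for w \<rho> L K z0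
  proof -
    define M where "M = L + K + 1"
    have M: "1 \<le> M" using LK by (simp add: M_def)
    obtain n a g where g: "g holomorphic_on ball 0 1" "\<And>i. i < n \<Longrightarrow> dist (a i) w \<le> \<rho>/2"
      "\<And>z. z \<in> ball 0 1 \<Longrightarrow> f z = (\<Prod>i<n. (z - a i) / of_real \<rho>) * g z"
      "\<And>z. z \<in> cball w (\<rho>/2) \<Longrightarrow> g z \<noteq> 0"
      "\<And>z. z \<in> cball w (2*\<rho>) \<Longrightarrow> norm (g z) \<le> exp L" "exp (- K) \<le> norm (g w)"
      "real n * ln 2 \<le> L + K"
    proof (rule factor_out_zeros[OF hol open_ball sub \<rho> _ fK])
      show "norm (f z) \<le> exp L" if "z \<in> cball w (2*\<rho>)" for z using fL that by blast
    qed (rule that)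
    have n: "real n \<le> 2 * M"
    proof -
      have "1/2 \<le> ln (2::real)" using ln2_ge_two_thirds by simp
      then have "real n * (1/2) \<le> real n * ln 2" by (intro mult_left_mono) auto
      then show ?thesis using g(7) by (simp add: M_def)
    qed
    define x where "x = (\<lambda>i. dist (a i) w / \<rho>)"
    have "\<exists>t. 1/8 < t \<and> t < 1/4 \<and> (\<forall>i<n. t \<noteq> x i) \<and> (\<Sum>i<n. 1 / \<bar>t - x i\<bar>) \<le> (B * real n) powr (1/\<alpha>)"
      unfolding B_def using \<alpha> g(2) \<rho> by (intro good_radius) (force simp: x_def field_simps)+
    then obtain t where t: "1/8 < t" "t < 1/4" "\<And>i. i < n \<Longrightarrow> t \<noteq> x i"
      "(\<Sum>i<n. 1 / \<bar>t - x i\<bar>) \<le> (B * real n) powr (1 + \<epsilon>)" using \<alpha> by auto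
    define E where "E = (\<Sum>i<n. 1 / \<bar>t - x i\<bar>)"
    have E0: "0 \<le> E" unfolding E_def by (intro sum_nonneg) auto
    \<comment> \<open>The growth rate of log |f| off the circle in units of \<open>\<rho>\<close>:
      \<open>E\<close> from the zeros, \<open>24 * M\<close> from the zero-free factor. The lower
      bound 24 keeps \<open>\<eta>\<close> below \<open>\<rho>/4\<close>, as
      \<open>zero_free_local_growth\<close> requires.\<close>
    define H where "H = E + 24 * M"
    have H: "24 \<le> H" "H \<le> D * M powr (1 + \<epsilon>)"
    proof -
      show "24 \<le> H" using E0 M by (simp add: H_def)
      have "E \<le> (B * (2 * M)) powr (1 + \<epsilon>)"
        using t(4) n B \<epsilon> unfolding E_def
        by (elim order_trans) (intro powr_mono2 mult_left_mono, auto)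
      also have "\<dots> = (2 * B) powr (1 + \<epsilon>) * M powr (1 + \<epsilon>)"
        using B M by (simp flip: powr_mult add: mult_ac)
      finally have "E \<le> (2 * B) powr (1 + \<epsilon>) * M powr (1 + \<epsilon>)" .
      moreover have "M powr 1 \<le> M powr (1 + \<epsilon>)" using M \<epsilon> by (intro powr_mono) auto
      ultimately show "H \<le> D * M powr (1 + \<epsilon>)" using M by (simp add: H_def D_def distrib_right)
    qed
    define \<eta> where "\<eta> = \<rho> / H"
    have \<eta>: "0 < \<eta>" "\<eta> < \<rho>/4" using H \<rho> by (auto simp: \<eta>_def field_simps)
    have in2: "ball w (\<rho>/2) \<subseteq> ball 0 1" "ball w (\<rho>/2) \<subseteq> cball w (2*\<rho>)"
      using sub \<rho> by (auto simp: subset_eq)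
    have circle: "norm (A z) \<le> C * (M powr (1 + \<epsilon>) / \<rho>) ^ k" if z: "dist w z = \<rho> * t" for z
    proof -
      have zw: "dist w z < \<rho>/4" using z t \<rho> by simp
      have z1: "z \<in> ball 0 1" "z \<in> cball w (\<rho>/2)" using in2 zw \<rho> by (auto simp: subset_eq)
      have dist_a: "\<rho> * \<bar>t - x i\<bar> \<le> norm (z - a i)" if "i < n" for i
      proof -
        have "\<rho> * \<bar>t - x i\<bar> = \<bar>dist w z - dist (a i) w\<bar>"
          using \<rho> z by (simp add: x_def abs_mult_pos' right_diff_distrib)
        also have "\<dots> \<le> norm (z - a i)" by norm
        finally show ?thesis .
      qed
      have za: "0 < norm (z - a i)" "0 < \<bar>t - x i\<bar>" if "i < n" for i
      proof -
        show *: "0 < \<bar>t - x i\<bar>" using t(3)[OF that] by simp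
        have "0 < \<rho> * \<bar>t - x i\<bar>" using * \<rho> by simp
        then show "0 < norm (z - a i)" using dist_a[OF that] by linarith
      qed
      have fz: "f z \<noteq> 0" using g(3)[OF z1(1)] g(4)[OF z1(2)] za \<rho> by auto
      have near: "norm (f \<zeta>) \<le> exp 1 * norm (f z)" if \<zeta>: "dist z \<zeta> \<le> \<eta>" for \<zeta>
      proof -
        have \<zeta>w: "\<zeta> \<in> ball w (\<rho>/2)"
          using dist_triangle[of w \<zeta> z] zw \<zeta> \<eta> by simp
        have "norm (\<Prod>i<n. (\<zeta> - a i) / of_real \<rho>) = (\<Prod>i<n. norm (\<zeta> - a i) / \<rho>)"
          using \<rho> by (simp add: norm_divide flip: prod_norm)
        also have "\<dots> \<le> (\<Prod>i<n. norm (z - a i) / \<rho> * exp (\<eta> / \<rho> * (1 / \<bar>t - x i\<bar>)))"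
        proof (rule prod_mono, safe)
          fix i assume i: "i < n"
          have "norm (\<zeta> - a i) \<le> norm (z - a i) + \<eta>" using \<zeta> by norm
          also have "\<dots> = norm (z - a i) * (1 + \<eta> / norm (z - a i))"
            using za[OF i] by (simp add: field_simps)
          also have "\<dots> \<le> norm (z - a i) * exp (\<eta> / \<rho> * (1 / \<bar>t - x i\<bar>))"
          proof (rule mult_left_mono)
            have "\<eta> / norm (z - a i) \<le> \<eta> / (\<rho> * \<bar>t - x i\<bar>)"
              using dist_a[OF i] za[OF i] \<rho> \<eta> by (intro divide_left_mono mult_pos_pos) auto
            then have "1 + \<eta> / norm (z - a i) \<le> 1 + \<eta> / \<rho> * (1 / \<bar>t - x i\<bar>)" by simp
            also have "\<dots> \<le> exp (\<eta> / \<rho> * (1 / \<bar>t - x i\<bar>))" by (rule exp_ge_add_one_self)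
            finally show "1 + \<eta> / norm (z - a i) \<le> exp (\<eta> / \<rho> * (1 / \<bar>t - x i\<bar>))" .
          qed simp
          finally have fin: "norm (\<zeta> - a i) \<le> norm (z - a i) * exp (\<eta> / \<rho> * (1 / \<bar>t - x i\<bar>))" .
          show "norm (\<zeta> - a i) / \<rho> \<le> norm (z - a i) / \<rho> * exp (\<eta> / \<rho> * (1 / \<bar>t - x i\<bar>))"
            using divide_right_mono[OF fin less_imp_le[OF \<rho>]] by (simp only: times_divide_eq_left)
          show "0 \<le> norm (\<zeta> - a i) / \<rho>" using \<rho> by simp
        qed
        also have "\<dots> = norm (\<Prod>i<n. (z - a i) / of_real \<rho>) * exp (\<eta> / \<rho> * E)"
          using \<rho> unfolding prod.distrib E_def sum_distrib_left
          by (simp add: norm_divide exp_sum flip: prod_norm)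
        finally have P: "norm (\<Prod>i<n. (\<zeta> - a i) / of_real \<rho>)
            \<le> norm (\<Prod>i<n. (z - a i) / of_real \<rho>) * exp (\<eta> / \<rho> * E)" .
        have "norm (g \<zeta>) \<le> exp (24 * (L + K + 1) * dist \<zeta> z / \<rho>) * norm (g z)"
        proof (rule zero_free_local_growth[where w = w])
          show "g holomorphic_on ball w (\<rho>/2)" using g(1) in2(1) by (rule holomorphic_on_subset)
          show "g z \<noteq> 0" if "z \<in> ball w (\<rho>/2)" for z using that by (intro g(4)) auto
          show "norm (g z) \<le> exp L" if "z \<in> ball w (\<rho>/2)" for z using that in2 by (intro g(5)) auto
        qed (use g(6) zw \<zeta> \<eta> in \<open>auto simp: dist_commute\<close>)
        also have "\<dots> \<le> exp (24 * M * \<eta> / \<rho>) * norm (g z)"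
          using \<zeta> M \<rho> by (intro mult_right_mono)
             (auto simp: M_def dist_commute intro!: divide_right_mono mult_left_mono)
        finally have G: "norm (g \<zeta>) \<le> exp (24 * M * \<eta> / \<rho>) * norm (g z)" .
        have "norm (f \<zeta>) = norm (\<Prod>i<n. (\<zeta> - a i) / of_real \<rho>) * norm (g \<zeta>)"
          using g(3)[OF subsetD[OF in2(1) \<zeta>w]] by (simp add: norm_mult)
        also have "\<dots> \<le> (norm (\<Prod>i<n. (z - a i) / of_real \<rho>) * exp (\<eta> / \<rho> * E)) * (exp (24 * M * \<eta> / \<rho>) * norm (g z))"
          using P G by (intro mult_mono) auto
        also have "\<dots> = exp (\<eta> / \<rho> * E + 24 * M * \<eta> / \<rho>) * norm (f z)"
          using g(3)[OF z1(1)] by (simp add: norm_mult exp_add)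
        also have "\<eta> / \<rho> * E + 24 * M * \<eta> / \<rho> = \<eta> / \<rho> * H" by (simp add: H_def algebra_simps)
        also have "\<dots> = 1" using \<rho> H by (simp add: \<eta>_def)
        finally show ?thesis .
      qed
      have cb: "cball z \<eta> \<subseteq> ball 0 1"
      proof
        fix \<zeta> assume "\<zeta> \<in> cball z \<eta>"
        then have "\<zeta> \<in> ball w (\<rho>/2)" using dist_triangle[of w \<zeta> z] zw \<eta> by simp
        then show "\<zeta> \<in> ball 0 1" by (rule subsetD[OF in2(1)])
      qed
      have "norm ((deriv ^^ k) f z) \<le> fact k * (exp 1 * norm (f z)) / \<eta> ^ k"
      proof (rule Cauchy_inequality)
        have hc: "f holomorphic_on cball z \<eta>" using hol cb by (rule holomorphic_on_subset)
        show "f holomorphic_on ball z \<eta>"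
          by (rule holomorphic_on_subset[OF hc ball_subset_cball])
        show "continuous_on (cball z \<eta>) f"
          by (rule holomorphic_on_imp_continuous_on[OF hc])
        show "norm (f y) \<le> exp 1 * norm (f z)" if "norm (z - y) = \<eta>" for y
          using that by (intro near) (simp add: dist_norm)
      qed (use \<eta> in auto)
      moreover have "norm ((deriv ^^ k) f z) = norm (A z) * norm (f z)"
      proof -
        have "(deriv ^^ k) f z = - (A z * f z)" using ode z1(1) by (simp add: eq_neg_iff_add_eq_0)
        then show ?thesis by (simp add: norm_mult)
      qed
      ultimately have "norm (A z) * norm (f z) \<le> (fact k * exp 1 / \<eta> ^ k) * norm (f z)" by simp
      then have "norm (A z) \<le> fact k * exp 1 / \<eta> ^ k"
        by (rule mult_right_le_imp_le) (use fz in auto)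
      also have "\<dots> = fact k * exp 1 * (H / \<rho>) ^ k" using H \<rho> by (simp add: \<eta>_def power_divide)
      also have "\<dots> \<le> fact k * exp 1 * (D * M powr (1 + \<epsilon>) / \<rho>) ^ k"
        using H \<rho> by (intro mult_left_mono power_mono divide_right_mono) auto
      also have "\<dots> = C * (M powr (1 + \<epsilon>) / \<rho>) ^ k"
        by (simp add: C_def power_divide power_mult_distrib)
      finally show ?thesis .
    qed
    have cs: "cball w (\<rho> * t) \<subseteq> ball 0 1"
    proof -
      have "\<rho> * t \<le> 2 * \<rho>" using t \<rho> by simp
      then have "cball w (\<rho> * t) \<subseteq> cball w (2 * \<rho>)" by (rule subset_cball)
      then show ?thesis using sub by blast
    qed
    have "norm (A z0) \<le> C * (M powr (1 + \<epsilon>) / \<rho>) ^ k"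
    proof (rule maximum_modulus_frontier[where S = "cball w (\<rho> * t)" and f = A])
      show "A holomorphic_on interior (cball w (\<rho> * t))"
        using holA cs interior_subset by (meson holomorphic_on_subset order_trans)
      show "continuous_on (closure (cball w (\<rho> * t))) A"
        using holomorphic_on_imp_continuous_on[OF holomorphic_on_subset[OF holA cs]] by simp
      have "\<rho> * (1/8) \<le> \<rho> * t" using t \<rho> by (intro mult_left_mono) auto
      then show "z0 \<in> cball w (\<rho> * t)" using z0 by auto
      fix z assume "z \<in> frontier (cball w (\<rho> * t))"
      then show "norm (A z) \<le> C * (M powr (1 + \<epsilon>) / \<rho>) ^ k"
        by (intro circle) (simp add: frontier_cball)
    qed auto
    then show ?thesis by (simp add: M_def)
  qed
  ultimately show ?thesis by blast
qed

text \<open>The zeros in \<open>cball 0 (7/8)\<close> are finite in number, so some radius between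
  3/4 and 7/8 avoids all their moduli. This circle is the starting scale for the propagation of
  lower bounds.\<close>

lemma zero_free_circle:
  fixes f :: "complex \<Rightarrow> complex"
  assumes hol: "f holomorphic_on ball 0 1" and nz: "\<exists>z\<in>ball 0 1. f z \<noteq> 0"
  shows "\<exists>R m. 0 < R \<and> R \<le> 1/4 \<and> 0 \<le> m \<and> (\<forall>u. norm u = 1 \<longrightarrow> exp (- m) \<le> norm (f (of_real (1 - R) * u)))"
proof -
  have fin: "finite {z \<in> cball 0 (7/8). f z = 0}"
  proof (cases "f constant_on ball 0 1")
    case True
    then obtain c where c: "\<And>z. z \<in> ball 0 1 \<Longrightarrow> f z = c" by (auto simp: constant_on_def)
    then have "c \<noteq> 0" using nz by auto
    moreover have "cball 0 (7/8) \<subseteq> ball (0::complex) 1" by auto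
    ultimately have "{z \<in> cball 0 (7/8). f z = 0} = {}" using c by blast
    then show ?thesis by (metis finite.emptyI)
  next
    case False
    then show ?thesis
      using hol by (intro holomorphic_compact_finite_zeros[where S = "ball 0 1"]) auto
  qed
  have "infinite {1/8..1/4::real}" by (simp add: infinite_Icc)
  then have "\<not> {1/8..1/4} \<subseteq> (\<lambda>z. 1 - norm z) ` {z \<in> cball 0 (7/8). f z = 0}"
    using fin by (meson finite_imageI finite_subset)
  then obtain R where "R \<in> {1/8..1/4}" and R3: "R \<notin> (\<lambda>z. 1 - norm z) ` {z \<in> cball 0 (7/8). f z = 0}"
    by blast
  then have R: "1/8 \<le> R" "R \<le> 1/4" by auto
  have fR: "f z \<noteq> 0" if "norm z = 1 - R" for z
  proof
    assume "f z = 0"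
    then have "1 - norm z \<in> (\<lambda>z. 1 - norm z) ` {z \<in> cball 0 (7/8). f z = 0}"
      using that R by (intro imageI) auto
    then show False using R3 that by simp
  qed
  have "continuous_on (sphere 0 (1 - R)) (\<lambda>z. norm (f z))"
    by (intro continuous_on_norm holomorphic_on_imp_continuous_on[OF holomorphic_on_subset[OF hol]])
       (use R in auto)
  moreover have "sphere (0::complex) (1 - R) \<noteq> {}" using R by simp
  ultimately obtain x where x: "norm x = 1 - R" "\<And>z. norm z = 1 - R \<Longrightarrow> norm (f x) \<le> norm (f z)"
    using continuous_attains_inf[of "sphere 0 (1 - R)" "\<lambda>z. norm (f z)"] by auto
  define m where "m = max 0 (- ln (norm (f x)))"
  have "exp (- m) \<le> norm (f (of_real (1 - R) * u))" if "norm u = 1" for u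
  proof -
    have "exp (- m) \<le> exp (ln (norm (f x)))" by (simp add: m_def)
    also have "\<dots> = norm (f x)" using fR[OF x(1)] by simp
    also have "\<dots> \<le> norm (f (of_real (1 - R) * u))"
      using that R by (intro x) (simp add: norm_mult del: of_real_diff)
    finally show ?thesis .
  qed
  then show ?thesis using R by (intro exI[of _ R] exI[of _ m]) (auto simp: m_def)
qed

text \<open>The lower bounds for |f| are fed into the local estimate. The exponent
  \<open>\<sigma>\<close> is global, while \<open>s\<close> is assumed at the scale
  \<open>\<delta>\<close> only. For \<open>s = \<sigma>\<close> the expression
  \<open>s + 1 - s/\<sigma>\<close> equals \<open>\<sigma>\<close>, which serves the upper bound for
  the degree; for \<open>s < \<sigma>\<close> it lies below \<open>\<sigma>\<close>, which serves
  the lower order.\<close>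

lemma coefficient_bound_from_solution:
  fixes f A :: "complex \<Rightarrow> complex" and k :: nat
  assumes hol: "f holomorphic_on ball 0 1" and holA: "A holomorphic_on ball 0 1"
    and ode: "\<forall>z\<in>ball 0 1. (deriv ^^ k) f z + A z * f z = 0"
    and nz: "\<exists>z\<in>ball 0 1. f z \<noteq> 0"
    and \<sigma>: "1 < \<sigma>" and h: "0 \<le> h"
    and fh: "\<And>z. norm z < 1 \<Longrightarrow> norm (f z) \<le> exp (h * (1 - norm z) powr (- \<sigma>))"
    and s: "0 < s" "s \<le> \<sigma>" and \<epsilon>: "0 < \<epsilon>" and h1: "0 \<le> h1"
  shows "\<exists>C>0. \<exists>\<delta>0>0. \<delta>0 \<le> 1/4 \<and> (\<forall>\<delta>. 0 < \<delta> \<longrightarrow> \<delta> < \<delta>0 \<longrightarrow>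
      (\<forall>z. norm z \<le> 1 - \<delta>/2 \<longrightarrow> norm (f z) \<le> exp (h1 * \<delta> powr (- s))) \<longrightarrow>
      (\<forall>z. norm z = 1 - \<delta> \<longrightarrow> norm (A z) \<le> C * \<delta> powr (- (real k * ((1 + \<epsilon>) * (s + 1 - s/\<sigma>) + 1)))))"
proof -
  obtain R1 m where R1: "0 < R1" "R1 \<le> 1/4" and m: "0 \<le> m"
    "\<And>u. norm u = 1 \<Longrightarrow> exp (- m) \<le> norm (f (of_real (1 - R1) * u))"
    using zero_free_circle[OF hol nz] by blast
  have "\<exists>C\<ge>0. \<forall>\<delta> u. 0 < \<delta> \<longrightarrow> \<delta> \<le> R1 \<longrightarrow> norm u = 1 \<longrightarrow>
           (\<exists>w. dist w (of_real (1 - \<delta>) * u) \<le> \<delta>/64 \<and> exp (- (C * \<delta> powr (- \<sigma>))) \<le> norm (f w))"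
  proof (rule lower_bound_iterate[OF hol \<sigma> R1 _ m(1) _ m(2)])
    show "0 \<le> h * 2 powr \<sigma>" using h by simp
    fix \<delta> and z :: complex assume d: "0 < \<delta>" "\<delta> \<le> R1" "norm z \<le> 1 - \<delta>/2"
    have "norm (f z) \<le> exp (h * (1 - norm z) powr (- \<sigma>))" using d R1 by (intro fh) auto
    also have "\<dots> \<le> exp (h * (\<delta>/2) powr (- \<sigma>))"
      using d h \<sigma> by (simp add: mult_left_mono powr_mono2')
    also have "(\<delta>/2) powr (- \<sigma>) = 2 powr \<sigma> * \<delta> powr (- \<sigma>)"
      using d by (simp add: powr_divide powr_minus field_simps)
    finally show "norm (f z) \<le> exp (h * 2 powr \<sigma> * \<delta> powr (- \<sigma>))" by (simp add: mult.assoc)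
  qed
  then obtain C0 where C0: "0 \<le> C0" "\<And>\<delta> u. 0 < \<delta> \<Longrightarrow> \<delta> \<le> R1 \<Longrightarrow> norm u = 1 \<Longrightarrow>
           \<exists>w. dist w (of_real (1 - \<delta>) * u) \<le> \<delta>/64 \<and> exp (- (C0 * \<delta> powr (- \<sigma>))) \<le> norm (f w)"
    by blast
  obtain Cl where Cl: "0 < Cl" "\<And>w \<rho> L K z. 0 < \<rho> \<Longrightarrow> cball w (2*\<rho>) \<subseteq> ball 0 1 \<Longrightarrow> 0 \<le> L \<Longrightarrow> 0 \<le> K \<Longrightarrow>
      (\<forall>z\<in>cball w (2*\<rho>). norm (f z) \<le> exp L) \<Longrightarrow> exp (- K) \<le> norm (f w) \<Longrightarrow>
      z\<in>cball w (\<rho>/8) \<Longrightarrow> norm (A z) \<le> Cl * ((L + K + 1) powr (1 + \<epsilon>) / \<rho>) ^ k"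
    using local_coefficient_bound[OF hol holA ode \<epsilon>] by blast
  define \<tau> where "\<tau> = s + 1 - s/\<sigma>"
  have \<tau>: "s \<le> \<tau>" using s \<sigma> by (simp add: \<tau>_def)
  define Q where "Q = h1 + 400 * (h1 + C0 + 1) + 1"
  have Q: "0 < Q" using h1 C0 by (simp add: Q_def)
  \<comment> \<open>Ensures \<open>\<delta> powr (s/\<sigma>) \<le> R1\<close>, so that the starting
    scale of the two-scale bound is admissible.\<close>
  define \<delta>0 where "\<delta>0 = R1 powr (\<sigma>/s)"
  have \<delta>0: "0 < \<delta>0" "\<delta>0 \<le> 1/4"
  proof -
    show "0 < \<delta>0" using R1 by (simp add: \<delta>0_def)
    have "R1 powr (\<sigma>/s) \<le> R1 powr 1" using R1 s by (intro powr_mono') auto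
    then show "\<delta>0 \<le> 1/4" using R1 by (simp add: \<delta>0_def)
  qed
  define C where "C = Cl * (8 * Q powr (1 + \<epsilon>)) ^ k"
  have "0 < C" using Cl Q by (simp add: C_def)
  moreover have "norm (A z) \<le> C * \<delta> powr (- (real k * ((1 + \<epsilon>) * \<tau> + 1)))"
    if \<delta>: "0 < \<delta>" "\<delta> < \<delta>0" and fs: "\<And>z. norm z \<le> 1 - \<delta>/2 \<Longrightarrow> norm (f z) \<le> exp (h1 * \<delta> powr (- s))"
      and z: "norm z = 1 - \<delta>" for \<delta> z
  proof -
    have \<delta>1: "\<delta> < 1/4" using \<delta> \<delta>0 by simp
    define u where "u = z / of_real (1 - \<delta>)"
    have u: "norm u = 1" "of_real (1 - \<delta>) * u = z"
      using z \<delta>1 by (simp_all add: u_def norm_divide del: of_real_diff)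
    have "\<delta> powr (s/\<sigma>) \<le> \<delta>0 powr (s/\<sigma>)" using \<delta> s \<sigma> by (intro powr_mono2) auto
    also have "\<dots> = R1" using R1 s \<sigma> by (simp add: \<delta>0_def powr_powr)
    finally have dR: "\<delta> powr (s/\<sigma>) \<le> R1" .
    have "\<exists>w. dist w (of_real (1 - \<delta>) * u) \<le> \<delta>/64 \<and>
           exp (- (400 * (h1 + C0 + 1) * \<delta> powr (- (s + 1 - s/\<sigma>)))) \<le> norm (f w)"
      by (rule lower_bound_two_scales[OF hol u(1) s R1(2) C0(1) h1 C0(2)[OF _ _ u(1)] \<delta>(1) dR fs])
    then obtain w where w: "dist w z \<le> \<delta>/64" "exp (- (400 * (h1 + C0 + 1) * \<delta> powr (- \<tau>))) \<le> norm (f w)"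
      unfolding u(2) \<tau>_def by blast
    \<comment> \<open>The local estimate is used with radius \<open>\<delta>/8\<close>. Its
      conclusion reaches distance \<open>\<delta>/64\<close> from \<open>w\<close>, the tolerance
      built into all the lower bounds, and its hypothesis concerns the disc of radius
      \<open>\<delta>/4\<close>, which stays within \<open>1 - \<delta>/2\<close>.\<close>
    have cb: "norm y \<le> 1 - \<delta>/2" if "y \<in> cball w (2*(\<delta>/8))" for y
    proof -
      have "norm y \<le> norm z + dist z w + dist w y"
        using norm_triangle_sub[of y z] dist_triangle[of z y w] by (simp add: dist_norm norm_minus_commute)
      then show ?thesis using that w z \<delta> by (simp add: dist_commute)
    qed
    have dt: "1 \<le> \<delta> powr (- \<tau>)" "\<delta> powr (- s) \<le> \<delta> powr (- \<tau>)"
    proof -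
      have "\<delta> powr 0 \<le> \<delta> powr (- \<tau>)" using \<delta> \<delta>1 s \<tau> by (intro powr_mono') auto
      then show "1 \<le> \<delta> powr (- \<tau>)" using \<delta> by simp
      show "\<delta> powr (- s) \<le> \<delta> powr (- \<tau>)" using \<delta> \<delta>1 \<tau> by (intro powr_mono') auto
    qed
    define LK where "LK = h1 * \<delta> powr (- s) + 400 * (h1 + C0 + 1) * \<delta> powr (- \<tau>) + 1"
    have "norm (A z) \<le> Cl * (LK powr (1 + \<epsilon>) / (\<delta>/8)) ^ k"
      unfolding LK_def
    proof (rule Cl(2)[OF _ _ _ _ _ w(2)])
      show "cball w (2*(\<delta>/8)) \<subseteq> ball 0 1"
      proof
        fix y assume "y \<in> cball w (2*(\<delta>/8))"
        from cb[OF this] show "y \<in> ball 0 1" using \<delta> by simp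
      qed
      show "\<forall>y\<in>cball w (2*(\<delta>/8)). norm (f y) \<le> exp (h1 * \<delta> powr (- s))" using cb fs by blast
    qed (use \<delta> h1 C0 w in auto)
    also have "\<dots> \<le> Cl * ((Q * \<delta> powr (- \<tau>)) powr (1 + \<epsilon>) / (\<delta>/8)) ^ k"
    proof -
      have "LK \<le> h1 * \<delta> powr (- \<tau>) + 400 * (h1 + C0 + 1) * \<delta> powr (- \<tau>) + 1 * \<delta> powr (- \<tau>)"
        unfolding LK_def using dt h1 C0(1) by (intro add_mono mult_left_mono) auto
      also have "\<dots> = Q * \<delta> powr (- \<tau>)" by (simp add: Q_def algebra_simps)
      finally have "LK \<le> Q * \<delta> powr (- \<tau>)" .
      moreover have "0 \<le> LK" using h1 C0 by (simp add: LK_def)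
      ultimately show ?thesis
        using Cl(1) \<delta> \<epsilon> by (intro mult_left_mono power_mono divide_right_mono powr_mono2) auto
    qed
    also have "(Q * \<delta> powr (- \<tau>)) powr (1 + \<epsilon>) / (\<delta>/8) = (8 * Q powr (1 + \<epsilon>)) * \<delta> powr (- ((1 + \<epsilon>) * \<tau> + 1))"
    proof -
      have "(Q * \<delta> powr (- \<tau>)) powr (1 + \<epsilon>) = Q powr (1 + \<epsilon>) * \<delta> powr (- ((1 + \<epsilon>) * \<tau>))"
        using Q by (simp add: powr_mult powr_powr mult.commute)
      then have "(Q * \<delta> powr (- \<tau>)) powr (1 + \<epsilon>) / (\<delta>/8)
          = 8 * Q powr (1 + \<epsilon>) * (\<delta> powr (- ((1 + \<epsilon>) * \<tau>)) / \<delta>)" by simp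
      also have "\<delta> powr (- ((1 + \<epsilon>) * \<tau>)) / \<delta> = \<delta> powr (- ((1 + \<epsilon>) * \<tau>) - 1)"
        using \<delta> by (simp add: powr_diff)
      also have "- ((1 + \<epsilon>) * \<tau>) - 1 = - ((1 + \<epsilon>) * \<tau> + 1)" by simp
      finally show ?thesis .
    qed
    also have "Cl * ((8 * Q powr (1 + \<epsilon>)) * \<delta> powr (- ((1 + \<epsilon>) * \<tau> + 1))) ^ k
        = C * \<delta> powr (real k * - ((1 + \<epsilon>) * \<tau> + 1))"
      using \<delta> by (simp add: C_def power_mult_distrib powr_power)
    also have "real k * - ((1 + \<epsilon>) * \<tau> + 1) = - (real k * ((1 + \<epsilon>) * \<tau> + 1))"
      by (rule mult_minus_right)
    finally show ?thesis .
  qed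
  ultimately show ?thesis using \<delta>0 unfolding \<tau>_def by blast
qed

section \<open>Existence of solutions\<close>

text \<open>Taylor coefficients at \<open>0\<close> of the solution with initial values \<open>1, 0, \<dots>, 0\<close>, where \<open>a\<close> are those of \<open>A\<close>.\<close>

function ode_coeff :: "nat \<Rightarrow> (nat \<Rightarrow> complex) \<Rightarrow> nat \<Rightarrow> complex" where
  "ode_coeff k a n = (if n = 0 then 1 else if n < k \<or> k = 0 then 0
     else - (\<Sum>j\<le>n-k. a j * ode_coeff k a (n - k - j)) * (fact (n - k) / fact n))"
  by pat_completeness auto
termination by (relation "Wellfounded.measure (\<lambda>(k, a, n). n)") auto

declare ode_coeff.simps [simp del]

lemma ode_coeff_add:
  assumes "1 \<le> k"
  shows "ode_coeff k a (n + k) = - (\<Sum>j\<le>n. a j * ode_coeff k a (n - j)) * (fact n / fact (n + k))"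
  using assms by (subst ode_coeff.simps) auto

text \<open>The convolution in the recursion, weighted by \<open>R ^ m\<close>, is at most
  \<open>S\<close> times a bound for the earlier terms, and the factorial quotient contributes at
  most 1/(m + 1). Once m is at least \<open>N\<close>, hence at least \<open>S\<close>, the product
  of the two factors is at most 1, so finitely many terms control all others.\<close>

lemma ode_coeff_weighted_bounded:
  assumes k: "1 \<le> k" and R: "0 < R" "R < 1" and sm: "summable (\<lambda>n. norm (a n) * R ^ n)"
  shows "\<exists>D. \<forall>n. norm (ode_coeff k a n) * R ^ n \<le> D"
proof -
  define S where "S = (\<Sum>n. norm (a n) * R ^ n)"
  have S: "(\<Sum>j\<le>n. norm (a j) * R ^ j) \<le> S" for n
    unfolding S_def using R by (intro sum_le_suminf[OF sm]) auto
  define d where "d = (\<lambda>n. norm (ode_coeff k a n) * R ^ n)"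
  have d0: "0 \<le> d n" for n using R by (simp add: d_def)
  obtain N where N: "S \<le> real N" using real_arch_simple by blast
  define D where "D = (\<Sum>i<N+k. d i)"
  have D0: "0 \<le> D" unfolding D_def using d0 by (intro sum_nonneg) auto
  have "d n \<le> D" for n
  proof (induction n rule: less_induct)
    case (less n)
    show ?case
    proof (cases "n < N + k")
      case True
      then show ?thesis unfolding D_def using d0 by (intro member_le_sum) auto
    next
      case False
      define m where "m = n - k"
      have n: "n = m + k" "N \<le> m" using False by (auto simp: m_def)
      have dn: "d n = norm (\<Sum>j\<le>m. a j * ode_coeff k a (m - j)) * R ^ m * (fact m / fact (m + k) * R ^ k)"
        unfolding d_def n ode_coeff_add[OF k] by (simp add: norm_mult norm_divide power_add)
      have "norm (\<Sum>j\<le>m. a j * ode_coeff k a (m - j)) * R ^ m \<le> (\<Sum>j\<le>m. norm (a j) * R ^ j * d (m - j))"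
      proof -
        have "norm (\<Sum>j\<le>m. a j * ode_coeff k a (m - j)) * R ^ m
            \<le> (\<Sum>j\<le>m. norm (a j * ode_coeff k a (m - j))) * R ^ m"
          using R by (intro mult_right_mono norm_sum) auto
        also have "\<dots> = (\<Sum>j\<le>m. norm (a j) * R ^ j * d (m - j))"
          unfolding sum_distrib_right d_def
        proof (intro sum.cong refl)
          fix j assume "j \<in> {..m}"
          then have "R ^ m = R ^ j * R ^ (m - j)" by (simp flip: power_add)
          then show "norm (a j * ode_coeff k a (m - j)) * R ^ m
              = norm (a j) * R ^ j * (norm (ode_coeff k a (m - j)) * R ^ (m - j))"
            by (simp add: norm_mult)
        qed
        finally show ?thesis .
      qed
      also have "\<dots> \<le> (\<Sum>j\<le>m. norm (a j) * R ^ j * D)"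
        using less n k R by (intro sum_mono mult_left_mono) auto
      also have "\<dots> \<le> S * D" using S D0 by (simp add: mult_right_mono flip: sum_distrib_right)
      finally have 1: "norm (\<Sum>j\<le>m. a j * ode_coeff k a (m - j)) * R ^ m \<le> S * D" .
      have 2: "fact m / fact (m + k) * R ^ k \<le> 1 / real (m + 1)"
      proof -
        have "fact (m + 1) \<le> (fact (m + k) :: real)" using k by (intro fact_mono) auto
        then have "real (m + 1) * fact m \<le> fact (m + k)" by simp
        then have "fact m / fact (m + k) \<le> 1 / real (m + 1)" by (simp add: field_simps)
        moreover have "fact m / fact (m + k) * R ^ k \<le> fact m / fact (m + k) * (1::real)"
          using R by (intro mult_left_mono power_le_one) auto
        ultimately show ?thesis by linarith
      qed
      have "0 \<le> S" using order_trans[OF norm_ge_zero[of "a 0"], of S] S[of 0] by simp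
      then have "d n \<le> S * D * (1 / real (m + 1))"
        unfolding dn using R D0 by (intro mult_mono 1 2) auto
      also have "\<dots> \<le> real (m + 1) * D * (1 / real (m + 1))"
        using N n D0 by (intro mult_right_mono) auto
      also have "\<dots> = D" by simp
      finally show ?thesis .
    qed
  qed
  then show ?thesis unfolding d_def by blast
qed

lemma fps_nth_higher_deriv:
  fixes F :: "complex fps"
  shows "fps_nth ((fps_deriv ^^ k) F) n = (fact (n + k) / fact n) * fps_nth F (n + k)"
proof (induction k arbitrary: n)
  case (Suc k)
  have "fps_nth ((fps_deriv ^^ Suc k) F) n = of_nat (Suc n) * (fact (Suc n + k) / fact (Suc n) * fps_nth F (Suc n + k))"
    using Suc.IH[of "Suc n"] by simp
  also have "of_nat (Suc n) * (fact (Suc n + k) / fact (Suc n) * fps_nth F (Suc n + k))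
      = fact (Suc n + k) / fact n * fps_nth F (Suc n + k)"
    by (simp add: fact_Suc[of n] del: of_nat_Suc)
  finally show ?case by simp
qed simp

lemma higher_deriv_eval_fps:
  fixes F :: "complex fps"
  assumes "fps_conv_radius F \<ge> 1"
  shows "fps_conv_radius ((fps_deriv ^^ j) F) \<ge> 1 \<and>
         (\<forall>z\<in>ball 0 1. (deriv ^^ j) (eval_fps F) z = eval_fps ((fps_deriv ^^ j) F) z)"
proof (induction j)
  case 0
  then show ?case using assms by simp
next
  case (Suc j)
  have "fps_conv_radius ((fps_deriv ^^ Suc j) F) \<ge> 1"
    using Suc fps_conv_radius_deriv[of "(fps_deriv ^^ j) F"] by (metis comp_apply funpow.simps(2) order_trans)
  moreover have "(deriv ^^ Suc j) (eval_fps F) z = eval_fps ((fps_deriv ^^ Suc j) F) z" if z: "z \<in> ball 0 1" for z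
  proof -
    have "\<forall>\<^sub>F w in nhds z. w \<in> ball 0 1" using z by (intro eventually_nhds_in_open) auto
    then have "\<forall>\<^sub>F w in nhds z. (deriv ^^ j) (eval_fps F) w = eval_fps ((fps_deriv ^^ j) F) w"
      by eventually_elim (use Suc in auto)
    then have "deriv ((deriv ^^ j) (eval_fps F)) z = deriv (eval_fps ((fps_deriv ^^ j) F)) z"
      by (rule deriv_cong_ev) simp
    also have "\<dots> = eval_fps (fps_deriv ((fps_deriv ^^ j) F)) z"
    proof (rule eval_fps_deriv[symmetric])
      have "ereal (norm z) < 1" using z by simp
      then show "ereal (norm z) < fps_conv_radius ((fps_deriv ^^ j) F)" using Suc by (blast intro: less_le_trans)
    qed
    finally show ?thesis by simp
  qed
  ultimately show ?case by blast
qed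

text \<open>The power series method. The weighted coefficient bound gives convergence in the disc,
  with \<open>R\<close> strictly between \<open>r\<close> and 1 to gain a geometric factor; the
  recursion is the equation between formal series, and evaluation carries it over to functions. The
  value 1 at 0 makes the solution non-trivial.\<close>

lemma solution_exists:
  fixes A :: "complex \<Rightarrow> complex"
  assumes k: "1 \<le> k" and hol: "A holomorphic_on ball 0 1"
  shows "\<exists>f. f holomorphic_on ball 0 1 \<and> (\<forall>z\<in>ball 0 1. (deriv ^^ k) f z + A z * f z = 0) \<and> f 0 = 1"
proof -
  define E where "E = fps_expansion A 0"
  have holE: "A holomorphic_on eball 0 (ereal 1)" using hol by simp
  have E1: "fps_conv_radius E \<ge> 1"
    using conv_radius_fps_expansion[OF holE] by (simp add: E_def one_ereal_def)
  have EA: "eval_fps E z = A z" if "norm z < 1" for z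
    using eval_fps_expansion'[OF holE, of z] that by (simp add: E_def)
  define F where "F = Abs_fps (ode_coeff k (fps_nth E))"
  have F1: "fps_conv_radius F \<ge> 1"
    unfolding fps_conv_radius_def
  proof (rule conv_radius_geI_ex)
    fix r :: real assume r: "0 < r" "ereal r < 1"
    define R where "R = (1 + r)/2"
    have R: "0 < R" "R < 1" "r < R" using r by (auto simp: R_def)
    have "ereal (norm (of_real R :: complex)) < conv_radius (fps_nth E)"
      using R E1 unfolding fps_conv_radius_def by (intro less_le_trans[OF _ E1[unfolded fps_conv_radius_def]]) auto
    from abs_summable_in_conv_radius[OF this]
    have "summable (\<lambda>n. norm (fps_nth E n) * R ^ n)" using R by (simp add: norm_mult norm_power)
    from ode_coeff_weighted_bounded[OF k R(1,2) this]
    obtain D where D: "\<And>n. norm (ode_coeff k (fps_nth E) n) * R ^ n \<le> D" by blast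
    have "summable (\<lambda>n. fps_nth F n * of_real r ^ n)"
    proof (rule summable_comparison_test')
      show "summable (\<lambda>n. D * (r/R) ^ n)" using R r by (intro summable_mult summable_geometric) auto
      fix n :: nat
      have "norm (fps_nth F n * of_real r ^ n) = (norm (ode_coeff k (fps_nth E) n) * R ^ n) * (r/R) ^ n"
        using R r by (simp add: F_def norm_mult norm_power power_divide)
      also have "\<dots> \<le> D * (r/R) ^ n" using D R r by (intro mult_right_mono) auto
      finally show "norm (fps_nth F n * of_real r ^ n) \<le> D * (r/R) ^ n" .
    qed
    then show "\<exists>z. norm z = r \<and> summable (\<lambda>n. fps_nth F n * z ^ n)"
      using r by (intro exI[of _ "of_real r"]) auto
  qed
  have FE: "(fps_deriv ^^ k) F = - (E * F)"
  proof (rule fps_ext)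
    fix n
    have "fps_nth ((fps_deriv ^^ k) F) n = (fact (n + k) / fact n) * ode_coeff k (fps_nth E) (n + k)"
      by (simp add: fps_nth_higher_deriv F_def)
    also have "\<dots> = - (\<Sum>j\<le>n. fps_nth E j * ode_coeff k (fps_nth E) (n - j))"
      unfolding ode_coeff_add[OF k] by simp
    also have "\<dots> = fps_nth (- (E * F)) n"
      by (simp add: fps_mult_nth F_def atLeast0AtMost)
    finally show "fps_nth ((fps_deriv ^^ k) F) n = fps_nth (- (E * F)) n" .
  qed
  define f where "f = eval_fps F"
  have "f holomorphic_on ball 0 1"
  proof -
    have "ball 0 1 \<subseteq> eball (0::complex) (fps_conv_radius F)"
    proof
      fix z :: complex assume "z \<in> ball 0 1"
      then have "ereal (norm z) < 1" by simp
      then have "ereal (norm z) < fps_conv_radius F" using F1 by (rule less_le_trans)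
      then show "z \<in> eball 0 (fps_conv_radius F)" by (simp add: in_eball_iff)
    qed
    then show ?thesis unfolding f_def by (rule holomorphic_on_eval_fps)
  qed
  moreover have "(deriv ^^ k) f z + A z * f z = 0" if z: "z \<in> ball 0 1" for z
  proof -
    have "ereal (norm z) < 1" using z by simp
    then have zr: "ereal (norm z) < fps_conv_radius E" "ereal (norm z) < fps_conv_radius F"
      using E1 F1 by (blast intro: less_le_trans)+
    have "(deriv ^^ k) f z = eval_fps (- (E * F)) z"
      using higher_deriv_eval_fps[OF F1, of k] z unfolding FE f_def by blast
    also have "\<dots> = - eval_fps (E * F) z"
      by (rule eval_fps_minus[OF less_le_trans[OF _ fps_conv_radius_mult]]) (use zr in simp)
    also have "\<dots> = - (A z * f z)"
      using eval_fps_mult[OF zr] EA z by (simp add: f_def)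
    finally show ?thesis by simp
  qed
  moreover have "f 0 = 1" by (simp add: f_def eval_fps_at_0 F_def ode_coeff.simps)
  ultimately show ?thesis by blast
qed

section \<open>Comparison of the growth quantities\<close>

text \<open>Radii up to \<open>b'\<close> are covered by the maximum modulus at \<open>b'\<close>,
  which the constant \<open>C\<close> absorbs. The monotone \<open>\<Phi>\<close> serves two
  applications: the exponential for solutions and the identity for coefficients.\<close>

lemma interior_bound_from_max_modulus:
  fixes \<Phi> :: "real \<Rightarrow> real"
  assumes hol: "f holomorphic_on ball 0 1" and mono: "mono \<Phi>" and e: "0 \<le> e" and b: "0 \<le> b" "b < 1"
    and M: "\<And>r. b < r \<Longrightarrow> r < 1 \<Longrightarrow> max_modulus r f \<le> \<Phi> ((1 - r) powr (- e))"
  shows "\<exists>C\<ge>1. \<forall>z. norm z < 1 \<longrightarrow> norm (f z) \<le> \<Phi> (C * (1 - norm z) powr (- e))"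
proof -
  define b' where "b' = (1 + b)/2"
  have b': "b < b'" "b' < 1" "0 < b'" using b by (auto simp: b'_def)
  have one: "1 \<le> x powr (- e)" if "0 < x" "x \<le> 1" for x :: real
    using powr_mono'[of "- e" 0 x] that e by simp
  define C where "C = (1 - b') powr (- e)"
  have C: "1 \<le> C" unfolding C_def using b' by (intro one) auto
  have "norm (f z) \<le> \<Phi> (C * (1 - norm z) powr (- e))" if z: "norm z < 1" for z
  proof (cases "norm z \<le> b'")
    case True
    have "norm (f z) \<le> max_modulus b' f" using hol b'(2) True by (rule norm_le_max_modulus)
    also have "\<dots> \<le> \<Phi> (C * 1)" using M[OF b'(1,2)] by (simp add: C_def)
    also have "\<dots> \<le> \<Phi> (C * (1 - norm z) powr (- e))"
      using C one[of "1 - norm z"] z by (intro monoD[OF mono] mult_left_mono) auto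
    finally show ?thesis .
  next
    case False
    have "norm (f z) \<le> max_modulus (norm z) f" using hol z by (rule norm_le_max_modulus) simp
    also have "\<dots> \<le> \<Phi> (1 * (1 - norm z) powr (- e))" using M[of "norm z"] False b' z by simp
    also have "\<dots> \<le> \<Phi> (C * (1 - norm z) powr (- e))"
      using C by (intro monoD[OF mono] mult_right_mono) auto
    finally show ?thesis .
  qed
  then show ?thesis using C by blast
qed

lemma growth_order_interior_bound:
  assumes hol: "f holomorphic_on ball 0 1" and "growth_order f \<le> ereal s" "s < \<sigma>" "0 \<le> \<sigma>"
  shows "\<exists>C\<ge>1. \<forall>z. norm z < 1 \<longrightarrow> norm (f z) \<le> exp (C * (1 - norm z) powr (- \<sigma>))"
proof -
  obtain b where b: "b < 1" "0 \<le> b"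
    "\<And>r. b < r \<Longrightarrow> r < 1 \<Longrightarrow> log_plus (max_modulus r f) \<le> (1 - r) powr (- \<sigma>)"
    using Limsup_log_ratioD[OF assms(2)[unfolded growth_order_def] assms(3,4)] by blast
  show ?thesis
  proof (rule interior_bound_from_max_modulus[OF hol _ assms(4) b(2,1)])
    show "mono (exp :: real \<Rightarrow> real)" by (simp add: mono_def)
    show "max_modulus r f \<le> exp ((1 - r) powr (- \<sigma>))" if "b < r" "r < 1" for r
      using b(3)[OF that] by (subst (asm) log_plus_le_iff) auto
  qed
qed

lemma growth_degree_interior_bound:
  assumes hol: "A holomorphic_on ball 0 1" and "growth_degree A \<le> ereal s" "s < p" "0 \<le> p"
  shows "\<exists>C\<ge>1. \<forall>z. norm z < 1 \<longrightarrow> norm (A z) \<le> C * (1 - norm z) powr (- p)"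
proof -
  obtain b where b: "b < 1" "0 \<le> b"
    "\<And>r. b < r \<Longrightarrow> r < 1 \<Longrightarrow> max_modulus r A \<le> (1 - r) powr (- p)"
    using Limsup_log_ratioD[OF assms(2)[unfolded growth_degree_def] assms(3,4)] by blast
  show ?thesis
    by (rule interior_bound_from_max_modulus[where \<Phi> = "\<lambda>x. x", OF hol _ assms(4) b(2,1) b(3)])
       (auto simp: mono_def)
qed

lemma log_plus_max_modulus_le:
  assumes "0 \<le> r" "0 \<le> y" "\<And>z. norm z = r \<Longrightarrow> norm (f z) \<le> exp y"
  shows "log_plus (max_modulus r f) \<le> y"
  using max_modulus_le[OF assms(1,3)] assms(2) by (simp add: log_plus_le_iff)

section \<open>Four inequalities for a fixed equation and a fixed non-trivial solution\<close>

context
  fixes k :: nat and f A :: "complex \<Rightarrow> complex"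
  assumes k: "1 \<le> k" and hol: "f holomorphic_on ball 0 1" and holA: "A holomorphic_on ball 0 1"
    and ode: "\<forall>z\<in>ball 0 1. (deriv ^^ k) f z + A z * f z = 0"
    and nz: "\<exists>z\<in>ball 0 1. f z \<noteq> 0"
begin

lemma growth_degree_le:
  assumes "growth_order f \<le> ereal s" "1 < s"
  shows "growth_degree A \<le> ereal (real k * (s + 1))"
  unfolding growth_degree_def
proof (rule Limsup_log_ratioI)
  show "0 \<le> real k * (s + 1)" using assms by simp
  fix y assume y: "real k * (s + 1) < y"
  define P where "P = y / real k"
  have P: "s + 1 < P" "real k * P = y" using y k by (auto simp: P_def field_simps)
  define \<sigma> where "\<sigma> = (s + P - 1)/2"
  have \<sigma>: "s < \<sigma>" "\<sigma> < P - 1" "1 < \<sigma>" using P assms by (auto simp: \<sigma>_def field_simps)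
  \<comment> \<open>Chosen so that \<open>(1 + \<epsilon>) * \<sigma> + 1 = P\<close>, which makes
    the exponent of the coefficient bound exactly \<open>y\<close>.\<close>
  define \<epsilon> where "\<epsilon> = (P - 1)/\<sigma> - 1"
  have \<epsilon>: "0 < \<epsilon>" using \<sigma> by (simp add: \<epsilon>_def)
  obtain h where h: "1 \<le> h" "\<And>z. norm z < 1 \<Longrightarrow> norm (f z) \<le> exp (h * (1 - norm z) powr (- \<sigma>))"
    using growth_order_interior_bound[OF hol assms(1) \<sigma>(1)] \<sigma> by auto
  have h0: "0 \<le> h" "0 \<le> h * 2 powr \<sigma>" and \<sigma>0: "0 < \<sigma>" using h(1) \<sigma>(3) by auto
  obtain C \<delta>0 where C: "0 < \<delta>0" "\<delta>0 \<le> 1/4"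
    "\<And>\<delta>. 0 < \<delta> \<Longrightarrow> \<delta> < \<delta>0 \<Longrightarrow> (\<forall>z. norm z \<le> 1 - \<delta>/2 \<longrightarrow> norm (f z) \<le> exp (h * 2 powr \<sigma> * \<delta> powr (- \<sigma>))) \<Longrightarrow>
      (\<forall>z. norm z = 1 - \<delta> \<longrightarrow> norm (A z) \<le> C * \<delta> powr (- (real k * ((1 + \<epsilon>) * (\<sigma> + 1 - \<sigma>/\<sigma>) + 1))))"
    using coefficient_bound_from_solution[OF hol holA ode nz \<sigma>(3) h0(1) h(2) _ order_refl \<epsilon> h0(2)] \<sigma>0
    by blast
  have ex: "real k * ((1 + \<epsilon>) * (\<sigma> + 1 - \<sigma>/\<sigma>) + 1) = y"
    using \<sigma> P(2) by (simp add: \<epsilon>_def)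
  have "max_modulus r A \<le> C * (1 - r) powr (- y)" if r: "1 - \<delta>0 < r" "r < 1" for r
  proof (rule max_modulus_le)
    show "0 \<le> r" using r C by simp
    define \<delta> where "\<delta> = 1 - r"
    have \<delta>: "0 < \<delta>" "\<delta> < \<delta>0" "r = 1 - \<delta>" using r by (auto simp: \<delta>_def)
    have "norm (f z) \<le> exp (h * 2 powr \<sigma> * \<delta> powr (- \<sigma>))" if z: "norm z \<le> 1 - \<delta>/2" for z
    proof -
      have "norm (f z) \<le> exp (h * (1 - norm z) powr (- \<sigma>))" using z \<delta> by (intro h) auto
      also have "\<dots> \<le> exp (h * (\<delta>/2) powr (- \<sigma>))"
        using z \<delta> h \<sigma> by (simp add: mult_left_mono powr_mono2')
      also have "(\<delta>/2) powr (- \<sigma>) = 2 powr \<sigma> * \<delta> powr (- \<sigma>)"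
        using \<delta> by (simp add: powr_divide powr_minus field_simps)
      finally show ?thesis by (simp add: mult.assoc)
    qed
    then show "norm (A z) \<le> C * (1 - r) powr (- y)" if "norm z = r" for z
      using C(3)[OF \<delta>(1,2)] that \<delta>(3) unfolding ex by simp
  qed
  then show "\<exists>C b. b < 1 \<and> (\<forall>r. b < r \<longrightarrow> r < 1 \<longrightarrow> max_modulus r A \<le> C * (1 - r) powr (- y))"
    using C(1) by (intro exI[of _ C] exI[of _ "1 - \<delta>0"]) auto
qed

lemma growth_order_le:
  assumes deg: "growth_degree A \<le> ereal p" and p: "real k < p"
  shows "growth_order f \<le> ereal (p / real k - 1)"
  unfolding growth_order_def
proof (rule Limsup_log_ratioI)
  show "0 \<le> p / real k - 1" using k p by simp
  fix y assume y: "p / real k - 1 < y"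
  \<comment> \<open>The case \<open>q' = q\<close> of the two-regime estimate gives the exponent
    \<open>q - 1 = y\<close>.\<close>
  define q where "q = y + 1"
  have "1 < p / real k" using k p by simp
  moreover have "p / real k < q" using y by (simp add: q_def)
  ultimately have "1 < q" by linarith
  moreover have "p < real k * q" using \<open>p / real k < q\<close> k by (simp add: divide_less_eq mult.commute)
  ultimately have q: "1 < q" "p < real k * q" by auto
  obtain C where C: "1 \<le> C" "\<And>z. norm z < 1 \<Longrightarrow> norm (A z) \<le> C * (1 - norm z) powr (- (real k * q))"
    using growth_degree_interior_bound[OF holA deg q(2)] q by auto
  obtain B where B: "0 \<le> B" "\<And>\<delta> q' u. 0 < \<delta> \<Longrightarrow> \<delta> < 1 \<Longrightarrow> 0 \<le> q' \<Longrightarrow> q' \<le> q \<Longrightarrow> norm u = 1 \<Longrightarrow>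
      (\<forall>z. norm z \<le> 1 - \<delta> \<longrightarrow> norm (A z) \<le> C * \<delta> powr (- (real k * q'))) \<Longrightarrow>
      norm (f (of_real (1 - \<delta>) * u)) \<le> exp (B * \<delta> powr (- (q'/q * (q - 1))))"
    using solution_growth_bound[OF hol k ode q(1) C] by blast
  have "log_plus (max_modulus r f) \<le> B * (1 - r) powr (- y)" if r: "0 < r" "r < 1" for r
  proof (rule log_plus_max_modulus_le)
    fix z :: complex assume z: "norm z = r"
    have "norm (f (of_real (1 - (1 - r)) * (z / of_real r))) \<le> exp (B * (1 - r) powr (- (q/q * (q - 1))))"
    proof (rule B(2))
      show "\<forall>z. norm z \<le> 1 - (1 - r) \<longrightarrow> norm (A z) \<le> C * (1 - r) powr (- (real k * q))"
      proof (intro allI impI)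
        fix z :: complex assume z: "norm z \<le> 1 - (1 - r)"
        then have "norm (A z) \<le> C * (1 - norm z) powr (- (real k * q))" using r by (intro C) auto
        also have "\<dots> \<le> C * (1 - r) powr (- (real k * q))"
          using z r C q by (intro mult_left_mono powr_mono2') auto
        finally show "norm (A z) \<le> C * (1 - r) powr (- (real k * q))" .
      qed
    qed (use r z q in \<open>auto simp: norm_divide\<close>)
    then show "norm (f z) \<le> exp (B * (1 - r) powr (- y))" using r q by (simp add: q_def)
  qed (use r B in auto)
  then show "\<exists>C b. b < 1 \<and> (\<forall>r. b < r \<longrightarrow> r < 1 \<longrightarrow> log_plus (max_modulus r f) \<le> C * (1 - r) powr (- y))"
    by (intro exI[of _ B] exI[of _ 0]) auto
qed

lemma lower_growth_order_ge:
  assumes deg: "growth_degree A \<le> ereal p" "ereal p \<le> lower_growth_degree A" and p: "2 * real k < p"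
  shows "ereal (p / real k - 1) \<le> lower_growth_order f"
proof -
  define \<sigma>0 where "\<sigma>0 = p / real k - 1"
  have \<sigma>0: "1 < \<sigma>0" "p = real k * (\<sigma>0 + 1)" using k p by (auto simp: \<sigma>0_def field_simps)
  have "ereal \<sigma>0 \<le> lower_growth_order f"
    unfolding lower_growth_order_def
  proof (rule Liminf_log_ratioI)
    show "0 < \<sigma>0" using \<sigma>0 by simp
    fix y assume y: "y < \<sigma>0" "0 \<le> y"
    show "\<exists>b<1. \<forall>r. b < r \<longrightarrow> r < 1 \<longrightarrow> (1 - r) powr (- y) < log_plus (max_modulus r f)"
    proof (rule ccontr)
      assume neg: "\<not> ?thesis"
      \<comment> \<open>The value \<open>\<sigma>0/2\<close> keeps the exponent positive when
        \<open>y = 0\<close>; enlarging \<open>y\<close> only weakens the bound on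
        \<open>f\<close>.\<close>
      define s where "s = max y (\<sigma>0/2)"
      have s: "0 < s" "s < \<sigma>0" "y \<le> s" using y \<sigma>0 by (auto simp: s_def)
      \<comment> \<open>An order of at most \<open>\<sigma>0\<close> bounds \<open>f\<close> only
        with exponents above \<open>\<sigma>0\<close>. The required inequality is strict at
        \<open>\<sigma>0\<close> itself, because (\<sigma>0 - s)(1 - 1/\<sigma>0) is positive, and
        by continuity it survives for some larger \<open>\<sigma>\<close>.\<close>
      have "((\<lambda>\<sigma>. s + 1 - s/\<sigma>) \<longlongrightarrow> s + 1 - s/\<sigma>0) (at_right \<sigma>0)"
        using \<sigma>0 by (intro tendsto_intros) auto
      moreover have "s + 1 - s/\<sigma>0 < \<sigma>0"
      proof -
        have "0 < (\<sigma>0 - s) * (1 - 1/\<sigma>0)" using s \<sigma>0 by simp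
        also have "\<dots> = \<sigma>0 - (s + 1 - s/\<sigma>0)" using \<sigma>0 by (simp add: field_simps)
        finally show ?thesis by simp
      qed
      ultimately have "\<forall>\<^sub>F \<sigma> in at_right \<sigma>0. s + 1 - s/\<sigma> < \<sigma>0" by (rule order_tendstoD)
      then have "\<forall>\<^sub>F \<sigma> in at_right \<sigma>0. s + 1 - s/\<sigma> < \<sigma>0 \<and> \<sigma>0 < \<sigma>"
        using eventually_at_right_less by (rule eventually_conj)
      then obtain \<sigma> where \<sigma>: "\<sigma>0 < \<sigma>" "s + 1 - s/\<sigma> < \<sigma>0"
        using eventually_happens'[OF trivial_limit_at_right_real] by blast
      have \<sigma>1: "1 < \<sigma>" "s \<le> \<sigma>" using \<sigma> \<sigma>0 s by auto
      define \<tau> where "\<tau> = s + 1 - s/\<sigma>"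
      have "s/\<sigma> \<le> 1" using \<sigma>1 by simp
      then have "0 < s + 1 - s/\<sigma>" using s by linarith
      then have \<tau>: "0 < \<tau>" "\<tau> < \<sigma>0" using \<sigma>(2) by (simp_all only: \<tau>_def)
      \<comment> \<open>Makes \<open>(1 + \<epsilon>) * \<tau>\<close> the midpoint of
        \<open>\<tau>\<close> and \<open>\<sigma>0\<close>, hence \<open>e < p\<close>.\<close>
      define \<epsilon> where "\<epsilon> = (\<sigma>0/\<tau> - 1)/2"
      have \<epsilon>: "0 < \<epsilon>" using \<tau> by (simp add: \<epsilon>_def)
      have "(1 + \<epsilon>) * \<tau> = (\<sigma>0 + \<tau>)/2" using \<tau> by (simp add: \<epsilon>_def field_simps)
      then have \<epsilon>': "(1 + \<epsilon>) * \<tau> < \<sigma>0" using \<tau> by simp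
      define e where "e = real k * ((1 + \<epsilon>) * \<tau> + 1)"
      have e: "e < p" "0 < e" using \<epsilon>' \<sigma>0 k \<tau> \<epsilon> by (auto simp: e_def intro!: mult_pos_pos add_pos_pos)
      define p' where "p' = (e + p)/2"
      have p': "e < p'" "p' < p" "0 \<le> p'" using e by (auto simp: p'_def)
      have ord: "growth_order f \<le> ereal \<sigma>0"
        using growth_order_le[OF deg(1)] p k unfolding \<sigma>0_def by simp
      obtain h where h: "1 \<le> h" "\<And>z. norm z < 1 \<Longrightarrow> norm (f z) \<le> exp (h * (1 - norm z) powr (- \<sigma>))"
        using growth_order_interior_bound[OF hol ord \<sigma>(1)] \<sigma>1 by auto
      have h0: "0 \<le> h" using h(1) by simp
      obtain C \<delta>0 where C: "0 < \<delta>0" "\<delta>0 \<le> 1/4"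
        "\<And>\<delta>. 0 < \<delta> \<Longrightarrow> \<delta> < \<delta>0 \<Longrightarrow> (\<forall>z. norm z \<le> 1 - \<delta>/2 \<longrightarrow> norm (f z) \<le> exp (2 powr s * \<delta> powr (- s))) \<Longrightarrow>
          (\<forall>z. norm z = 1 - \<delta> \<longrightarrow> norm (A z) \<le> C * \<delta> powr (- e))"
        using coefficient_bound_from_solution[OF hol holA ode nz \<sigma>1(1) h0 h(2) s(1) \<sigma>1(2) \<epsilon> powr_ge_zero[of 2 s]]
        unfolding \<tau>_def e_def by blast
      obtain b0 where b0: "b0 < 1" "\<And>r. b0 < r \<Longrightarrow> r < 1 \<Longrightarrow> (1 - r) powr (- p') < max_modulus r A"
        using Liminf_log_ratioD[OF deg(2)[unfolded lower_growth_degree_def] p'(2,3)] by blast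
      obtain d where d: "0 < d" "\<And>\<delta>. 0 < \<delta> \<Longrightarrow> \<delta> < d \<Longrightarrow> C * \<delta> powr (- e) < \<delta> powr (- p')"
        using powr_neg_absorb_const[OF p'(1), of C] by blast
      define m where "m = min \<delta>0 (min d (1 - b0))"
      have m: "0 < m" using C d b0 by (simp add: m_def)
      have mle: "m \<le> \<delta>0" "m \<le> d" "m \<le> 1 - b0" by (auto simp: m_def)
      have "1 - m/2 < 1" using m by simp
      then obtain r where r: "1 - m/2 < r" "r < 1" "log_plus (max_modulus r f) \<le> (1 - r) powr (- y)"
        using neg unfolding not_less[symmetric] by blast
      \<comment> \<open>A bound for \<open>f\<close> on the disc of radius
        \<open>1 - \<delta>/2\<close> controls \<open>A\<close> only at radius
        \<open>1 - \<delta>\<close>, so the distance to the boundary is doubled; the factor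
        \<open>2 powr s\<close> pays for it.\<close>
      define \<delta> where "\<delta> = 2 * (1 - r)"
      have \<delta>: "0 < \<delta>" "\<delta> < \<delta>0" "\<delta> < d" "\<delta> < 1 - b0" "r = 1 - \<delta>/2"
      proof -
        show "0 < \<delta>" "\<delta> < \<delta>0" "\<delta> < d" "\<delta> < 1 - b0" using r mle by (simp_all add: \<delta>_def)
        show "r = 1 - \<delta>/2" by (simp add: \<delta>_def diff_divide_distrib)
      qed
      have "norm (f z) \<le> exp (2 powr s * \<delta> powr (- s))" if z: "norm z \<le> 1 - \<delta>/2" for z
      proof -
        have "norm (f z) \<le> max_modulus r f" using z \<delta> by (intro norm_le_max_modulus[OF hol]) auto
        also have "\<dots> \<le> exp ((1 - r) powr (- y))" using r(3) by (simp add: log_plus_le_iff)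
        also have "\<dots> \<le> exp ((\<delta>/2) powr (- s))" using \<delta> s C by (simp add: powr_mono')
        also have "(\<delta>/2) powr (- s) = 2 powr s * \<delta> powr (- s)"
          using \<delta> by (simp add: powr_divide powr_minus field_simps)
        finally show ?thesis .
      qed
      then have "norm (A z) \<le> C * \<delta> powr (- e)" if "norm z = 1 - \<delta>" for z
        using C(3)[OF \<delta>(1,2)] that by blast
      then have "max_modulus (1 - \<delta>) A \<le> C * \<delta> powr (- e)"
        using \<delta> C by (intro max_modulus_le) auto
      also have "\<dots> < \<delta> powr (- p')" using d \<delta> by blast
      also have "\<dots> < max_modulus (1 - \<delta>) A" using b0(2)[of "1 - \<delta>"] \<delta> by simp
      finally show False .
    qed
  qed
  then show ?thesis by (simp add: \<sigma>0_def)
qed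

text \<open>If |A| has exponent y < p at one radius, the maximum principle extends this bound to the
  disc of that radius. The two-regime estimate with q' = y/k and q slightly above p/k then bounds
  log |f| at this radius with exponent (q'/q)(q - 1), which is below p/k - 1 and contradicts the
  lower order.\<close>

lemma lower_growth_degree_ge:
  assumes deg: "growth_degree A \<le> ereal p" and ord: "ereal (p / real k - 1) \<le> lower_growth_order f"
    and p: "2 * real k < p"
  shows "ereal p \<le> lower_growth_degree A"
  unfolding lower_growth_degree_def
proof (rule Liminf_log_ratioI)
  define P where "P = p / real k"
  have P: "2 < P" "p = real k * P" using k p by (auto simp: P_def field_simps)
  show "0 < p" using p by simp
  fix y assume y: "y < p" "0 \<le> y"
  show "\<exists>b<1. \<forall>r. b < r \<longrightarrow> r < 1 \<longrightarrow> (1 - r) powr (- y) < max_modulus r A"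
  proof (rule ccontr)
    assume neg: "\<not> ?thesis"
    define q' where "q' = y / real k"
    have q': "0 \<le> q'" "q' < P" "real k * q' = y" using y k by (auto simp: q'_def P_def field_simps)
    \<comment> \<open>The degree bounds \<open>A\<close> only with exponents above \<open>p\<close>,
      so \<open>q\<close> must exceed \<open>P\<close>; continuity keeps the resulting exponent
      below \<open>P - 1\<close>.\<close>
    have "((\<lambda>q. q' / q * (q - 1)) \<longlongrightarrow> q' / P * (P - 1)) (at_right P)"
      using P by (intro tendsto_intros) auto
    moreover have "q' / P * (P - 1) < P - 1"
      using mult_strict_right_mono[of "q' / P" 1 "P - 1"] P q' by simp
    ultimately have "\<forall>\<^sub>F q in at_right P. q' / q * (q - 1) < P - 1" by (rule order_tendstoD)
    then have "\<forall>\<^sub>F q in at_right P. q' / q * (q - 1) < P - 1 \<and> P < q"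
      using eventually_at_right_less by (rule eventually_conj)
    then obtain q where q: "P < q" "q' / q * (q - 1) < P - 1"
      using eventually_happens'[OF trivial_limit_at_right_real] by blast
    define e where "e = q' / q * (q - 1)"
    define e' where "e' = (e + (P - 1))/2"
    have "0 \<le> e" using q q' P by (simp add: e_def)
    moreover have "e < P - 1" using q by (simp only: e_def)
    ultimately have e: "e < e'" "e' < P - 1" "0 \<le> e'" using P by (auto simp: e'_def)
    have kq: "p < real k * q" using q P k by simp
    obtain C where C: "1 \<le> C" "\<And>z. norm z < 1 \<Longrightarrow> norm (A z) \<le> C * (1 - norm z) powr (- (real k * q))"
      using growth_degree_interior_bound[OF holA deg kq] q P by auto
    have q1: "1 < q" using q P by simp
    obtain B where B: "0 \<le> B" "\<And>\<delta> q' u. 0 < \<delta> \<Longrightarrow> \<delta> < 1 \<Longrightarrow> 0 \<le> q' \<Longrightarrow> q' \<le> q \<Longrightarrow> norm u = 1 \<Longrightarrow>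
        (\<forall>z. norm z \<le> 1 - \<delta> \<longrightarrow> norm (A z) \<le> C * \<delta> powr (- (real k * q'))) \<Longrightarrow>
        norm (f (of_real (1 - \<delta>) * u)) \<le> exp (B * \<delta> powr (- (q'/q * (q - 1))))"
      using solution_growth_bound[OF hol k ode q1 C] by blast
    obtain b0 where b0: "b0 < 1" "0 \<le> b0" "\<And>r. b0 < r \<Longrightarrow> r < 1 \<Longrightarrow> (1 - r) powr (- e') < log_plus (max_modulus r f)"
      using Liminf_log_ratioD[OF ord[unfolded lower_growth_order_def] _ e(3)] e(2) unfolding P_def by blast
    obtain d where d: "0 < d" "\<And>\<delta>. 0 < \<delta> \<Longrightarrow> \<delta> < d \<Longrightarrow> B * \<delta> powr (- e) < \<delta> powr (- e')"
      using powr_neg_absorb_const[OF e(1), of B] by blast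
    have "max b0 (1 - d) < 1" using b0 d by simp
    then obtain r where r: "max b0 (1 - d) < r" "r < 1" "max_modulus r A \<le> (1 - r) powr (- y)"
      using neg unfolding not_less[symmetric] by blast
    have r0: "0 < r" using r b0 by simp
    have "log_plus (max_modulus r f) \<le> B * (1 - r) powr (- e)"
    proof (rule log_plus_max_modulus_le)
      fix z :: complex assume z: "norm z = r"
      have "norm (f (of_real (1 - (1 - r)) * (z / of_real r))) \<le> exp (B * (1 - r) powr (- (q'/q * (q - 1))))"
      proof (rule B(2))
        show "\<forall>z. norm z \<le> 1 - (1 - r) \<longrightarrow> norm (A z) \<le> C * (1 - r) powr (- (real k * q'))"
        proof (intro allI impI)
          fix z :: complex assume z: "norm z \<le> 1 - (1 - r)"
          have "norm (A z) \<le> max_modulus r A" using z r by (intro norm_le_max_modulus[OF holA]) auto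
          also have "\<dots> \<le> 1 * (1 - r) powr (- y)" using r by simp
          also have "\<dots> \<le> C * (1 - r) powr (- y)" using C by (intro mult_right_mono) auto
          finally show "norm (A z) \<le> C * (1 - r) powr (- (real k * q'))" unfolding q' .
        qed
      qed (use r r0 z q q' in \<open>auto simp: norm_divide\<close>)
      then show "norm (f z) \<le> exp (B * (1 - r) powr (- e))" using r0 by (simp add: e_def)
    qed (use r0 B in auto)
    also have "\<dots> < (1 - r) powr (- e')" using d r by simp
    also have "\<dots> < log_plus (max_modulus r f)" using b0 r by simp
    finally show False .
  qed
qed

end

section \<open>The cycle of implications\<close>

lemma lower_growth_le_growth:
  "lower_growth_order f \<le> growth_order f" "lower_growth_degree f \<le> growth_degree f"
  unfolding lower_growth_order_def growth_order_def lower_growth_degree_def growth_degree_def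
  by (rule Liminf_le_Limsup[OF trivial_limit_at_left_real])+

theorem theorem1:
  fixes k :: nat and p :: real and A :: "complex \<Rightarrow> complex"
  assumes "k \<ge> 1" and "A holomorphic_on ball 0 1"
  defines "P1 \<equiv> growth_degree A = ereal p \<and> lower_growth_degree A = ereal p \<and> p > 2 * real k"
  defines "P2 \<equiv> (\<exists>f. nontrivial_solution k A f \<and>
             growth_order f = ereal (p / real k - 1) \<and>
             lower_growth_order f = ereal (p / real k - 1) \<and> p / real k - 1 > 1)"
  defines "P3 \<equiv> (\<forall>f. nontrivial_solution k A f \<longrightarrow>
             growth_order f = ereal (p / real k - 1) \<and>
             lower_growth_order f = ereal (p / real k - 1) \<and> p / real k - 1 > 1)"
  shows "(P1 \<longleftrightarrow> P2) \<and> (P2 \<longleftrightarrow> P3)"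
proof -
  have p_iff: "p / real k - 1 > 1 \<longleftrightarrow> p > 2 * real k"
    using assms(1) by (auto simp: field_simps)
  have "P3" if P1
  proof -
    have deg: "growth_degree A \<le> ereal p" "ereal p \<le> lower_growth_degree A" and p: "2 * real k < p"
      using that by (auto simp: P1_def)
    have "growth_order f = ereal (p / real k - 1) \<and> lower_growth_order f = ereal (p / real k - 1)"
      if "nontrivial_solution k A f" for f
    proof -
      have f: "f holomorphic_on ball 0 1" "\<forall>z\<in>ball 0 1. (deriv ^^ k) f z + A z * f z = 0"
        "\<exists>z\<in>ball 0 1. f z \<noteq> 0" using that by (auto simp: nontrivial_solution_def)
      note sol = assms(1) f(1) assms(2) f(2,3)
      have "growth_order f \<le> ereal (p / real k - 1)"
        using growth_order_le[OF sol deg(1)] p assms(1) by simp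
      moreover have "ereal (p / real k - 1) \<le> lower_growth_order f"
        by (rule lower_growth_order_ge[OF sol deg p])
      ultimately show ?thesis using lower_growth_le_growth(1)[of f] by (auto intro: antisym order_trans)
    qed
    then show P3 using p p_iff by (simp add: P3_def)
  qed
  \<comment> \<open>Without a solution on the whole disc the universal statement could hold
    vacuously; the solution with \<open>f 0 = 1\<close> is the witness.\<close>
  moreover have P2 if P3
  proof -
    obtain f where "f holomorphic_on ball 0 1" "\<forall>z\<in>ball 0 1. (deriv ^^ k) f z + A z * f z = 0" "f 0 = 1"
      using solution_exists[OF assms(1,2)] by blast
    then have "nontrivial_solution k A f"
      unfolding nontrivial_solution_def by (auto intro!: bexI[of _ 0])
    then show P2 using that unfolding P2_def P3_def by blast
  qed
  moreover have P1 if P2': P2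
  proof -
    obtain f where "nontrivial_solution k A f" and ord: "growth_order f = ereal (p / real k - 1)"
        "lower_growth_order f = ereal (p / real k - 1)" "p / real k - 1 > 1"
      using P2' unfolding P2_def by blast
    then have f: "f holomorphic_on ball 0 1" "\<forall>z\<in>ball 0 1. (deriv ^^ k) f z + A z * f z = 0"
        "\<exists>z\<in>ball 0 1. f z \<noteq> 0" by (auto simp: nontrivial_solution_def)
    note sol = assms(1) f(1) assms(2) f(2,3)
    have p: "2 * real k < p" using ord p_iff by simp
    have deg: "growth_degree A \<le> ereal p"
      using growth_degree_le[OF sol _ ord(3)] ord(1) assms(1) by simp
    moreover have "ereal p \<le> lower_growth_degree A"
      by (rule lower_growth_degree_ge[OF sol deg _ p]) (simp add: ord)
    ultimately show P1 using p lower_growth_le_growth(2)[of A] by (auto simp: P1_def intro: antisym order_trans)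
  qed
  ultimately show ?thesis by blast
qed

end
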